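(* Let $q$ be the order of a skew symmetric core. Then for each positive integer $m$ there is a regular $\mathrm{QUH}(q^m,q)$, $H$, with $|S(H)| = q^{3m/2}$. Furthermore, if $q$ is an odd prime power with $q\equiv 3 \pmod 4$, then a skew symmetric core $Q$ of order $q$ can be chosen so that, for every positive integer $m$, the matrix $$H_m=\frac{1}{\sqrt{q+1}}\,\mathcal{J}^{(q)}_m + i\sqrt{\frac{q}{q+1}}\,\mathcal{A}^{(q)}_m$$ constructed from $Q$ is a regular $\mathrm{QUH}(q^m,q)$ with $|S(H_m)|=q^{3m/2}$ and is multicirculant.
   Context: A unit Hadamard matrix of order $n$ is an $n\times n$ complex matrix $H$ all of whose entries have modulus $1$ and with $HH^*=nI_n$. For positive integers $n,m$, a $\mathrm{QUH}(n,m)$ (quaternary unit Hadamard matrix) is a unit Hadamard matrix of order $n$ all of whose entries lie in the four-element set $\left\{\epsilon\frac{1}{\sqrt{m+1}}+\delta\, i\sqrt{\frac{m}{m+1}} : \epsilon,\delta\in\{1,-1\}\right\}$. For a matrix $A$, $S(A)$ (the excess) denotes the sum of all entries of $A$. A unit Hadamard matrix of order $n$ is regular if, for every row, the sum of the entries of that row has modulus $\sqrt n$. A Hadamard matrix of order $n$ is an $n\times n$ $(\pm1)$-matrix $H$ with $HH^T=nI_n$; it is of skew type if $H=I+W$ with $W$ a skew symmetric $(0,\pm1)$-matrix. A skew symmetric core of order $q$ is a $q\times q$ matrix $Q$ such that $\begin{pmatrix}1 & j\\ -j^T & I+Q\end{pmatrix}$ is a skew type Hadamard matrix of order $q+1$,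 where $j$ is the $1\times q$ all-ones matrix. Such $Q$ is a skew symmetric $(0,\pm1)$-matrix with $J_qQ=QJ_q=0$ and $QQ^T=qI_q-J_q$, where $J_n$ denotes the $n\times n$ all-ones matrix. Given a skew symmetric core $Q$ of order $q$, define recursively $\mathcal{J}^{(q)}_0=\mathcal{A}^{(q)}_0=J_1$ and, for $m\ge1$, $\mathcal{J}^{(q)}_m=J_q\otimes\mathcal{A}^{(q)}_{m-1}$, $\mathcal{A}^{(q)}_m=I_q\otimes\mathcal{J}^{(q)}_{m-1}+Q\otimes\mathcal{A}^{(q)}_{m-1}$. A block-circulant matrix is a matrix of the form $\mathrm{circ}(A_1,\dots,A_k)$, i.e. the circulant arrangement with first block row $(A_1,\dots,A_k)$ of square blocks $A_i$ of equal order. Multicirculant matrices are defined recursively: every matrix of order $1$ is multicirculant; a matrix of order $n>1$ is multicirculant if and only if it is a block-circulant matrix (with $k\ge 2$ blocks per row, so that the blocks have smaller order) whose blocks are multicirculant. *)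

theory Defs
  imports
    "Jordan_Normal_Form.Schur_Decomposition"
    "HOL-Number_Theory.Prime_Powers"
begin

definition ones_mat :: "nat \<Rightarrow> nat \<Rightarrow> 'a :: one mat" where
  "ones_mat r c = mat r c (\<lambda>_. 1)"

definition kronecker :: "'a :: times mat \<Rightarrow> 'a mat \<Rightarrow> 'a mat" where
  "kronecker A B = mat (dim_row A * dim_row B) (dim_col A * dim_col B)
     (\<lambda>(i, j). A $$ (i div dim_row B, j div dim_col B) * B $$ (i mod dim_row B, j mod dim_col B))"

definition unit_hadamard :: "nat \<Rightarrow> complex mat \<Rightarrow> bool" where
  "unit_hadamard n H \<longleftrightarrow>
     H \<in> carrier_mat n n \<and> (\<forall>h \<in> elements_mat H. cmod h = 1) \<and>
     H * mat_adjoint H = of_nat n \<cdot>\<^sub>m 1\<^sub>m n"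

definition QUH_entries :: "nat \<Rightarrow> complex set" where
  "QUH_entries m =
     {\<epsilon> * complex_of_real (1 / sqrt (real m + 1))
        + \<delta> * \<i> * complex_of_real (sqrt (real m / (real m + 1)))
      | \<epsilon> \<delta>. \<epsilon> \<in> {1, -1} \<and> \<delta> \<in> {1, -1}}"

definition QUH :: "nat \<Rightarrow> nat \<Rightarrow> complex mat \<Rightarrow> bool" where
  "QUH n m H \<longleftrightarrow> 0 < n \<and> 0 < m \<and> unit_hadamard n H \<and> elements_mat H \<subseteq> QUH_entries m"

definition regular_unit_hadamard :: "nat \<Rightarrow> complex mat \<Rightarrow> bool" where
  "regular_unit_hadamard n H \<longleftrightarrow>
     unit_hadamard n H \<and> (\<forall>i<n. cmod (\<Sum>j<n. H $$ (i, j)) = sqrt (real n))"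

definition hadamard :: "nat \<Rightarrow> int mat \<Rightarrow> bool" where
  "hadamard n H \<longleftrightarrow>
     H \<in> carrier_mat n n \<and> elements_mat H \<subseteq> {1, -1} \<and>
     H * transpose_mat H = int n \<cdot>\<^sub>m 1\<^sub>m n"

definition skew_type_hadamard :: "nat \<Rightarrow> int mat \<Rightarrow> bool" where
  "skew_type_hadamard n H \<longleftrightarrow>
     hadamard n H \<and>
     (\<exists>W \<in> carrier_mat n n. elements_mat W \<subseteq> {0, 1, -1} \<and> transpose_mat W = - W \<and>
        H = 1\<^sub>m n + W)"

(* Orders are positive; this excludes the empty matrix, whose bordering is the 1 x 1 matrix (1). *)
definition skew_symmetric_core :: "nat \<Rightarrow> int mat \<Rightarrow> bool" where
  "skew_symmetric_core q Q \<longleftrightarrow>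
     0 < q \<and> Q \<in> carrier_mat q q \<and>
     skew_type_hadamard (q + 1)
       (four_block_mat (ones_mat 1 1) (ones_mat 1 q)
          (- transpose_mat (ones_mat 1 q)) (1\<^sub>m q + Q))"

fun calJ calA :: "nat \<Rightarrow> int mat \<Rightarrow> nat \<Rightarrow> int mat" where
  "calJ q Q 0 = ones_mat 1 1"
| "calA q Q 0 = ones_mat 1 1"
| "calJ q Q (Suc m) = kronecker (ones_mat q q) (calA q Q m)"
| "calA q Q (Suc m) = kronecker (1\<^sub>m q) (calJ q Q m) + kronecker Q (calA q Q m)"

definition core_QUH :: "nat \<Rightarrow> int mat \<Rightarrow> nat \<Rightarrow> complex mat" where
  "core_QUH q Q m =
     complex_of_real (1 / sqrt (real q + 1)) \<cdot>\<^sub>m map_mat of_int (calJ q Q m)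
     + (\<i> * complex_of_real (sqrt (real q / (real q + 1)))) \<cdot>\<^sub>m map_mat of_int (calA q Q m)"

(* circ(A_0, ..., A_{k-1}) for s x s blocks: the block in position (a, b) is A_{(b - a) mod k}.
   The summand k avoids truncated subtraction. *)
definition block_circ :: "nat \<Rightarrow> 'a mat list \<Rightarrow> 'a mat" where
  "block_circ s As = (let k = length As in
     mat (k * s) (k * s)
       (\<lambda>(i, j). (As ! ((k + j div s - i div s) mod k)) $$ (i mod s, j mod s)))"

inductive multicirculant :: "'a mat \<Rightarrow> bool" where
  order_one: "A \<in> carrier_mat 1 1 \<Longrightarrow> multicirculant A"
| block: "\<lbrakk>2 \<le> length As; \<And>A. A \<in> set As \<Longrightarrow> A \<in> carrier_mat s s;
           \<And>A. A \<in> set As \<Longrightarrow> multicirculant A\<rbrakk>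
          \<Longrightarrow> multicirculant (block_circ s As)"

end

theory Submission
  imports Defs
begin

text \<open>
  Mixed products of Kronecker products give inductively, with \<open>J = calJ q Q m\<close> and
  \<open>A = calA q Q m\<close>, the relations \<open>J A\<^sup>T = A J\<^sup>T\<close> and \<open>J J\<^sup>T + q A A\<^sup>T = (q + 1) q\<^sup>m I\<close>;
  the row sums \<open>a\<close>, \<open>b\<close> of \<open>J\<close>, \<open>A\<close> are constant and satisfy \<open>a\<^sup>2 + q b\<^sup>2 = (q + 1) q\<^sup>m\<close>.
  This is all that is needed for the first part.

  For \<open>q = p\<^sup>k\<close> with \<open>q mod 4 = 3\<close> take the Paley core \<open>\<chi> (\<beta> j - \<beta> i)\<close>, where \<open>\<chi>\<close> is the quadratic
  character of the field with \<open>q\<close> elements and \<open>\<beta>\<close> lists its elements by their coordinates over the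
  prime field, so that the core depends only on the digitwise difference of \<open>i\<close> and \<open>j\<close> in base \<open>p\<close>.
  The recursion preserves this dependence, which means multicirculant with \<open>p\<close> blocks at every level.

  The field is realised without quotients as \<open>\<int>[\<zeta>]\<close> modulo a prime ideal \<open>M\<close> containing \<open>p\<close>, for a
  primitive complex \<open>(q - 1)\<close>-th root of unity \<open>\<zeta>\<close>; representatives are \<open>0\<close> and the powers of \<open>\<zeta>\<close>.
\<close>

section \<open>Kronecker products\<close>

text \<open>Each index below \<open>b * d\<close> is \<open>x * d + y\<close> for a unique pair of
  digits, so the inner summation in a product of Kronecker products becomes a double sum.\<close>

lemma sum_div_mod:
  fixes g :: "nat \<Rightarrow> nat \<Rightarrow> 'a :: comm_monoid_add"
  shows "(\<Sum>l<b * d. g (l div d) (l mod d)) = (\<Sum>x<b. \<Sum>y<d. g x y)"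
proof -
  have less: "x * d + y < b * d" if "x < b" "y < d" for x y
    by (metis that add.commute mod_less div_less div_mult_self1 add_0 less_mult_imp_div_less
        div_less_iff_less_mult gr0I less_nat_zero_code)
  have "(\<Sum>l<b * d. g (l div d) (l mod d)) = (\<Sum>(x, y)\<in>{..<b} \<times> {..<d}. g x y)"
    by (rule sum.reindex_bij_witness[where j = "\<lambda>l. (l div d, l mod d)" and i = "\<lambda>(x, y). x * d + y"])
      (auto simp: less less_mult_imp_div_less intro!: mod_less_divisor gr0I)
  then show ?thesis by (simp add: sum.cartesian_product)
qed

lemma kronecker_carrier [simp, intro]:
  "A \<in> carrier_mat a b \<Longrightarrow> B \<in> carrier_mat c d \<Longrightarrow> kronecker A B \<in> carrier_mat (a * c) (b * d)"
  by (auto simp: kronecker_def)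

lemma kronecker_index:
  assumes "A \<in> carrier_mat a b" "B \<in> carrier_mat c d" "i < a * c" "j < b * d"
  shows "kronecker A B $$ (i, j) = A $$ (i div c, j div d) * B $$ (i mod c, j mod d)"
  using assms by (auto simp: kronecker_def)

text \<open>In the double sum over the two digits of the inner index, each factor involves only one
  digit, so the sum factors. The Gram and row sum identities below rest on this mixed-product
  rule.\<close>

lemma kronecker_mult:
  fixes A B C D :: "'a :: comm_semiring_0 mat"
  assumes A: "A \<in> carrier_mat a b" and B: "B \<in> carrier_mat c d"
    and C: "C \<in> carrier_mat b e" and D: "D \<in> carrier_mat d f"
  shows "kronecker A B * kronecker C D = kronecker (A * C) (B * D)"
proof (rule eq_matI)
  fix i j assume "i < dim_row (kronecker (A * C) (B * D))" "j < dim_col (kronecker (A * C) (B * D))"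
  then have i: "i < a * c" and j: "j < e * f" using assms by (auto simp: kronecker_def)
  then have c: "0 < c" and f: "0 < f" by (auto intro!: gr0I)
  have i': "i div c < a" "i mod c < c" and j': "j div f < e" "j mod f < f"
    using i j c f by (auto simp: less_mult_imp_div_less)
  have "(kronecker A B * kronecker C D) $$ (i, j)
      = (\<Sum>l<b * d. kronecker A B $$ (i, l) * kronecker C D $$ (l, j))"
    using assms i j by (auto simp: scalar_prod_def kronecker_def lessThan_atLeast0)
  also have "\<dots> = (\<Sum>l<b * d. (A $$ (i div c, l div d) * C $$ (l div d, j div f))
        * (B $$ (i mod c, l mod d) * D $$ (l mod d, j mod f)))"
    by (intro sum.cong refl)
      (simp add: kronecker_index[OF A B i] kronecker_index[OF C D _ j] algebra_simps)
  also have "\<dots> = (\<Sum>x<b. \<Sum>y<d. (A $$ (i div c, x) * C $$ (x, j div f))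
        * (B $$ (i mod c, y) * D $$ (y, j mod f)))"
    by (rule sum_div_mod)
  also have "\<dots> = (\<Sum>x<b. A $$ (i div c, x) * C $$ (x, j div f))
        * (\<Sum>y<d. B $$ (i mod c, y) * D $$ (y, j mod f))"
    by (rule sum_product[symmetric])
  also have "\<dots> = (A * C) $$ (i div c, j div f) * (B * D) $$ (i mod c, j mod f)"
    using assms i' j' by (simp add: scalar_prod_def lessThan_atLeast0)
  also have "\<dots> = kronecker (A * C) (B * D) $$ (i, j)"
    using kronecker_index[of "A * C" a e "B * D" c f i j] assms i j by auto
  finally show "(kronecker A B * kronecker C D) $$ (i, j) = kronecker (A * C) (B * D) $$ (i, j)" .
qed (use assms in \<open>auto simp: kronecker_def\<close>)

lemma kronecker_transpose:
  "transpose_mat (kronecker A B) = kronecker (transpose_mat A) (transpose_mat B)"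
proof (rule eq_matI)
  fix i j assume *: "i < dim_row (kronecker (transpose_mat A) (transpose_mat B))"
    "j < dim_col (kronecker (transpose_mat A) (transpose_mat B))"
  then have "0 < dim_row B" "0 < dim_col B" by (auto simp: kronecker_def intro!: gr0I)
  then show "transpose_mat (kronecker A B) $$ (i, j)
      = kronecker (transpose_mat A) (transpose_mat B) $$ (i, j)"
    using * by (auto simp: kronecker_def less_mult_imp_div_less)
qed (auto simp: kronecker_def)

lemma kronecker_one: "kronecker (1\<^sub>m a) (1\<^sub>m b) = (1\<^sub>m (a * b) :: 'a :: semiring_1 mat)"
proof (rule eq_matI)
  fix i j assume "i < dim_row (1\<^sub>m (a * b) :: 'a mat)" "j < dim_col (1\<^sub>m (a * b) :: 'a mat)"
  then have *: "i < a * b" "j < a * b" by auto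
  then have "0 < b" by (auto intro!: gr0I)
  moreover have "i = j" if "i div b = j div b" "i mod b = j mod b"
    using that by (metis div_mult_mod_eq)
  ultimately show "kronecker (1\<^sub>m a) (1\<^sub>m b) $$ (i, j) = (1\<^sub>m (a * b) :: 'a mat) $$ (i, j)"
    using * by (auto simp: kronecker_def less_mult_imp_div_less)
qed (auto simp: kronecker_def)

lemma kronecker_add_left:
  fixes A B C :: "'a :: semiring mat"
  assumes "A \<in> carrier_mat a b" "B \<in> carrier_mat a b"
  shows "kronecker (A + B) C = kronecker A C + kronecker B C"
  using assms
  by (intro eq_matI) (auto simp: kronecker_def less_mult_imp_div_less algebra_simps)

lemma kronecker_add_right:
  fixes A B C :: "'a :: semiring mat"
  assumes B: "B \<in> carrier_mat c d" and C: "C \<in> carrier_mat c d"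
  shows "kronecker A (B + C) = kronecker A B + kronecker A C"
proof (rule eq_matI)
  fix i j assume *: "i < dim_row (kronecker A B + kronecker A C)" "j < dim_col (kronecker A B + kronecker A C)"
  then have "0 < c" "0 < d" using assms by (auto simp: kronecker_def intro!: gr0I)
  then show "kronecker A (B + C) $$ (i, j) = (kronecker A B + kronecker A C) $$ (i, j)"
    using * assms by (auto simp: kronecker_def algebra_simps)
qed (use assms in \<open>auto simp: kronecker_def\<close>)

lemma kronecker_smult_left:
  "kronecker (k \<cdot>\<^sub>m A) B = k \<cdot>\<^sub>m kronecker A (B :: 'a :: comm_semiring_1 mat)"
  by (intro eq_matI) (auto simp: kronecker_def less_mult_imp_div_less algebra_simps)

lemma kronecker_smult_right:
  "kronecker A (k \<cdot>\<^sub>m B) = k \<cdot>\<^sub>m kronecker A (B :: 'a :: comm_semiring_1 mat)"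
proof (rule eq_matI)
  fix i j assume *: "i < dim_row (k \<cdot>\<^sub>m kronecker A B)" "j < dim_col (k \<cdot>\<^sub>m kronecker A B)"
  then have "0 < dim_row B" "0 < dim_col B" by (auto simp: kronecker_def intro!: gr0I)
  then show "kronecker A (k \<cdot>\<^sub>m B) $$ (i, j) = (k \<cdot>\<^sub>m kronecker A B) $$ (i, j)"
    using * by (auto simp: kronecker_def algebra_simps)
qed (auto simp: kronecker_def)

section \<open>All-ones matrices\<close>

lemma ones_mat_carrier [simp, intro]: "ones_mat r c \<in> carrier_mat r c"
  by (simp add: ones_mat_def)

lemma ones_mat_index [simp]: "i < r \<Longrightarrow> j < c \<Longrightarrow> ones_mat r c $$ (i, j) = 1"
  by (simp add: ones_mat_def)

lemma ones_mat_dim [simp]: "dim_row (ones_mat r c) = r" "dim_col (ones_mat r c) = c"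
  by (simp_all add: ones_mat_def)

lemma transpose_ones_mat [simp]: "transpose_mat (ones_mat r c) = ones_mat c r"
  by (intro eq_matI) (auto simp: ones_mat_def)

lemma ones_mat_mult:
  "ones_mat a b * ones_mat b c = of_nat b \<cdot>\<^sub>m (ones_mat a c :: 'a :: semiring_1 mat)"
  by (intro eq_matI) (auto simp: scalar_prod_def)

lemma kronecker_ones: "kronecker (ones_mat a b) (ones_mat c d) = (ones_mat (a * c) (b * d) :: 'a :: semiring_1 mat)"
proof (rule eq_matI)
  fix i j assume *: "i < dim_row (ones_mat (a * c) (b * d) :: 'a mat)"
    "j < dim_col (ones_mat (a * c) (b * d) :: 'a mat)"
  then have "0 < c" "0 < d" by (auto intro!: gr0I)
  then show "kronecker (ones_mat a b) (ones_mat c d) $$ (i, j)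
      = (ones_mat (a * c) (b * d) :: 'a mat) $$ (i, j)"
    using * by (auto simp: kronecker_def less_mult_imp_div_less)
qed (auto simp: kronecker_def)

section \<open>Skew symmetric cores and the associated unit Hadamard matrices\<close>

text \<open>Products of rows of the bordered matrix carry the information: against the constant
  first row they give the vanishing row sums of \<open>Q\<close>, against each other its Gram
  matrix. The Gram relation is stated as a sum because the recursion meets exactly this sum as a
  Kronecker factor.\<close>

lemma skew_symmetric_coreD:
  assumes "skew_symmetric_core q Q"
  shows "0 < q" "Q \<in> carrier_mat q q"
    "\<And>i. i < q \<Longrightarrow> Q $$ (i, i) = 0"
    "\<And>i j. i < q \<Longrightarrow> j < q \<Longrightarrow> i \<noteq> j \<Longrightarrow> Q $$ (i, j) \<in> {1, -1}"
    "transpose_mat Q = - Q"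
    "Q * transpose_mat Q + ones_mat q q = int q \<cdot>\<^sub>m 1\<^sub>m q"
    "Q * ones_mat q 1 = 0\<^sub>m q 1"
proof -
  define H :: "int mat" where "H = four_block_mat (ones_mat 1 1) (ones_mat 1 q)
          (- transpose_mat (ones_mat 1 q)) (1\<^sub>m q + Q)"
  from assms show q: "0 < q" and Q: "Q \<in> carrier_mat q q"
    by (auto simp: skew_symmetric_core_def)
  from assms have H: "H \<in> carrier_mat (q + 1) (q + 1)" "elements_mat H \<subseteq> {1, -1}"
      and HH: "H * transpose_mat H = int (q + 1) \<cdot>\<^sub>m 1\<^sub>m (q + 1)"
    by (auto simp: H_def skew_symmetric_core_def skew_type_hadamard_def hadamard_def)
  from assms obtain W where W: "W \<in> carrier_mat (q + 1) (q + 1)" "transpose_mat W = - W"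
      and HW: "H = 1\<^sub>m (q + 1) + W"
    by (auto simp: H_def skew_symmetric_core_def skew_type_hadamard_def)
  have h: "H $$ (Suc i, Suc j) = (if i = j then 1 else 0) + Q $$ (i, j)" if "i < q" "j < q" for i j
    using that Q by (simp add: H_def)
  have h0: "H $$ (0, j) = 1" if "j < q + 1" for j
    using that Q q by (simp add: H_def)
  have h1: "H $$ (Suc i, 0) = -1" if "i < q" for i
    using that Q by (simp add: H_def)
  have w: "W $$ (Suc i, Suc j) = Q $$ (i, j)" if "i < q" "j < q" for i j
    using h[OF that] that W Q unfolding HW by simp
  have skew: "Q $$ (j, i) = - Q $$ (i, j)" if "i < q" "j < q" for i j
  proof -
    have "transpose_mat W $$ (Suc i, Suc j) = (- W) $$ (Suc i, Suc j)" using W by simp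
    then show ?thesis using that W(1) w by simp
  qed
  show "transpose_mat Q = - Q"
    using Q by (intro eq_matI) (auto intro: skew)
  show diag: "Q $$ (i, i) = 0" if "i < q" for i
    using skew[OF that that] by linarith
  show "Q $$ (i, j) \<in> {1, -1}" if "i < q" "j < q" "i \<noteq> j" for i j
  proof -
    have "H $$ (Suc i, Suc j) \<in> elements_mat H"
      using that by (intro elements_matI[OF H(1)]) auto
    then have "H $$ (Suc i, Suc j) \<in> {1, -1}" using H(2) by blast
    then show ?thesis using h[OF that(1,2)] that by simp
  qed
  have prod: "(\<Sum>l<q+1. H $$ (i, l) * H $$ (j, l)) = (if i = j then int (q + 1) else 0)"
    if "i < q + 1" "j < q + 1" for i j
  proof -
    have "(H * transpose_mat H) $$ (i, j) = (\<Sum>l<q+1. H $$ (i, l) * H $$ (j, l))"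
      using H(1) that by (simp add: scalar_prod_def lessThan_atLeast0)
    then show ?thesis using that unfolding HH by (cases "i = j") (simp_all del: sum.lessThan_Suc)
  qed
  have row: "(\<Sum>l<q. Q $$ (i, l)) = 0" if i: "i < q" for i
  proof -
    have "(\<Sum>l<q+1. H $$ (Suc i, l) * H $$ (0, l)) = 0"
      using prod[of "Suc i" 0] i by (simp del: sum.lessThan_Suc)
    also have "(\<Sum>l<q+1. H $$ (Suc i, l) * H $$ (0, l))
        = -1 + (\<Sum>l<q. H $$ (Suc i, Suc l) * H $$ (0, Suc l))"
      using i by (simp add: sum.lessThan_Suc_shift h0 h1 del: sum.lessThan_Suc)
    also have "(\<Sum>l<q. H $$ (Suc i, Suc l) * H $$ (0, Suc l)) = (\<Sum>l<q. (if i = l then 1 else 0) + Q $$ (i, l))"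
      by (intro sum.cong refl) (simp add: i h h0)
    also have "\<dots> = 1 + (\<Sum>l<q. Q $$ (i, l))"
      using i by (simp add: sum.distrib)
    finally show ?thesis by simp
  qed
  then show "Q * ones_mat q 1 = 0\<^sub>m q 1"
    using Q by (intro eq_matI) (auto simp: scalar_prod_def lessThan_atLeast0)
  have QQ: "(\<Sum>l<q. Q $$ (i, l) * Q $$ (j, l)) + 1 = (if i = j then int q else 0)"
    if ij: "i < q" "j < q" for i j
  proof -
    have "(if i = j then int (q + 1) else 0) = (\<Sum>l<q+1. H $$ (Suc i, l) * H $$ (Suc j, l))"
      using prod[of "Suc i" "Suc j"] ij by (simp del: sum.lessThan_Suc)
    also have "\<dots> = 1 + (\<Sum>l<q. H $$ (Suc i, Suc l) * H $$ (Suc j, Suc l))"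
      using ij by (simp add: sum.lessThan_Suc_shift h1 del: sum.lessThan_Suc)
    \<comment> \<open>Two rows of \<open>I + Q\<close> are multiplied out. The identity picks out
      \<open>Q $$ (j, i)\<close> and \<open>Q $$ (i, j)\<close>, which cancel by skewness.\<close>
    also have "(\<Sum>l<q. H $$ (Suc i, Suc l) * H $$ (Suc j, Suc l))
        = (\<Sum>l<q. (if i = l \<and> j = l then 1 else 0) + (if l = i then Q $$ (j, l) else 0)
             + (if l = j then Q $$ (i, l) else 0) + Q $$ (i, l) * Q $$ (j, l))"
      by (intro sum.cong refl) (use ij h in \<open>auto simp: algebra_simps\<close>)
    also have "\<dots> = (\<Sum>l<q. (if i = l \<and> j = l then 1 else 0)) + Q $$ (j, i) + Q $$ (i, j)
        + (\<Sum>l<q. Q $$ (i, l) * Q $$ (j, l))"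
      using ij by (simp add: sum.distrib)
    also have "(\<Sum>l<q. (if i = l \<and> j = l then 1 else 0::int)) = (if i = j then 1 else 0)"
      using ij by (cases "i = j") (auto intro!: sum.neutral)
    finally show ?thesis using skew[OF ij] by (auto split: if_splits)
  qed
  then show "Q * transpose_mat Q + ones_mat q q = int q \<cdot>\<^sub>m 1\<^sub>m q"
    using Q by (intro eq_matI) (auto simp: scalar_prod_def lessThan_atLeast0)
qed

lemma pm1_kronecker_ones:
  fixes A :: "int mat"
  assumes "A \<in> carrier_mat n n" "\<And>i j. i < n \<Longrightarrow> j < n \<Longrightarrow> A $$ (i, j) \<in> {1, -1}" "i < q * n" "j < q * n"
  shows "kronecker (ones_mat q q) A $$ (i, j) \<in> {1, -1}"
proof -
  have "0 < n" using assms by (auto intro!: gr0I)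
  then show ?thesis
    using assms(2)[of "i mod n" "j mod n"] assms(3,4)
    by (simp add: kronecker_index[OF ones_mat_carrier assms(1)] less_mult_imp_div_less)
qed

lemma calJ_calA_carrier:
  assumes "Q \<in> carrier_mat q q"
  shows "calJ q Q m \<in> carrier_mat (q ^ m) (q ^ m) \<and> calA q Q m \<in> carrier_mat (q ^ m) (q ^ m)"
proof (induction m)
  case 0
  then show ?case by simp
next
  case (Suc m)
  then show ?case using assms by (auto intro!: add_carrier_mat kronecker_carrier)
qed

text \<open>The diagonal of \<open>Q\<close> vanishes, so the two summands of \<open>calA\<close>
  have disjoint supports: diagonal blocks are copies of \<open>calJ\<close>, all others are
  \<open>calA\<close> up to sign.\<close>

lemma calJ_calA_entries:
  assumes Q: "skew_symmetric_core q Q"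
  shows "i < q ^ m \<Longrightarrow> j < q ^ m \<Longrightarrow>
    calJ q Q m $$ (i, j) \<in> {1, -1} \<and> calA q Q m $$ (i, j) \<in> {1, -1}"
proof (induction m arbitrary: i j)
  case 0
  then show ?case by simp
next
  case (Suc m)
  note core = skew_symmetric_coreD[OF Q]
  let ?J = "calJ q Q m" and ?A = "calA q Q m"
  have J: "?J \<in> carrier_mat (q ^ m) (q ^ m)" and A: "?A \<in> carrier_mat (q ^ m) (q ^ m)"
    using calJ_calA_carrier[OF core(2)] by auto
  have n: "0 < q ^ m" using core(1) by simp
  have i: "i < q * q ^ m" "j < q * q ^ m" using Suc.prems by auto
  then have d: "i div q ^ m < q" "j div q ^ m < q" "i mod q ^ m < q ^ m" "j mod q ^ m < q ^ m"
    using n by (auto simp: less_mult_imp_div_less)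
  have "calJ q Q (Suc m) $$ (i, j) \<in> {1, -1}"
    using pm1_kronecker_ones[OF A _ i] Suc.IH by auto
  moreover have "calA q Q (Suc m) $$ (i, j)
      = (if i div q ^ m = j div q ^ m then ?J $$ (i mod q ^ m, j mod q ^ m)
         else Q $$ (i div q ^ m, j div q ^ m) * ?A $$ (i mod q ^ m, j mod q ^ m))"
  proof -
    have "calA q Q (Suc m) $$ (i, j)
      = kronecker (1\<^sub>m q) ?J $$ (i, j) + kronecker Q ?A $$ (i, j)"
      using kronecker_carrier[OF core(2) A] i by simp
    then show ?thesis
      using d core(3)[of "j div q ^ m"]
      by (simp add: kronecker_index[OF one_carrier_mat J i] kronecker_index[OF core(2) A i])
  qed
  ultimately show ?case
    using core(4)[OF d(1,2)] Suc.IH[OF d(3,4)] by auto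
qed

lemma zero_kronecker: "A \<in> carrier_mat c d \<Longrightarrow>
    kronecker (0\<^sub>m a b) A = (0\<^sub>m (a * c) (b * d) :: 'a :: semiring_0 mat)"
  by (intro eq_matI) (auto simp: kronecker_def less_mult_imp_div_less)

lemma kronecker_uminus_left:
  "kronecker (- A) B = - kronecker A (B :: 'a :: ring mat)"
  by (intro eq_matI) (auto simp: kronecker_def less_mult_imp_div_less)

text \<open>The first identity will remove the imaginary part of \<open>H * mat_adjoint H\<close>,
  the second determines its real part. In the induction step \<open>Q\<close> and the all-ones
  matrix annihilate each other, leaving one term in each mixed product, and the cross terms of the
  Gram matrix of \<open>calA\<close> cancel by skewness and the first identity.\<close>

lemma calJ_calA_gram:
  assumes Q: "skew_symmetric_core q Q"
  shows "calJ q Q m * transpose_mat (calA q Q m) = calA q Q m * transpose_mat (calJ q Q m) \<and>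
    calJ q Q m * transpose_mat (calJ q Q m) + int q \<cdot>\<^sub>m (calA q Q m * transpose_mat (calA q Q m))
      = int ((q + 1) * q ^ m) \<cdot>\<^sub>m 1\<^sub>m (q ^ m)"
proof (induction m)
  case 0
  then show ?case by (auto intro!: eq_matI simp: ones_mat_mult)
next
  case (Suc m)
  note core = skew_symmetric_coreD[OF Q]
  let ?n = "q ^ m" and ?j = "ones_mat q q :: int mat" and ?I = "1\<^sub>m q :: int mat"
  define J A where "J = calJ q Q m" and "A = calA q Q m"
  have J: "J \<in> carrier_mat ?n ?n" and A: "A \<in> carrier_mat ?n ?n"
    using calJ_calA_carrier[OF core(2)] by (auto simp: J_def A_def)
  have Jt: "transpose_mat J \<in> carrier_mat ?n ?n" and At: "transpose_mat A \<in> carrier_mat ?n ?n"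
    using J A by auto
  have nQ: "- Q \<in> carrier_mat q q" using core(2) by simp
  have IH1: "J * transpose_mat A = A * transpose_mat J"
    and IH2: "J * transpose_mat J + int q \<cdot>\<^sub>m (A * transpose_mat A) = int ((q + 1) * ?n) \<cdot>\<^sub>m 1\<^sub>m ?n"
    using Suc.IH by (auto simp: J_def A_def)
  have KQ: "kronecker Q A \<in> carrier_mat (q * ?n) (q * ?n)" "kronecker ?I J \<in> carrier_mat (q * ?n) (q * ?n)"
    using core(2) A J by auto
  \<comment> \<open>The core relation concerns the all-ones column only; writing the all-ones matrix
    as column times row extends it, and transposing gives the other side.\<close>
  have jQ: "?j * - Q = 0\<^sub>m q q" and Qj: "Q * ?j = 0\<^sub>m q q"
  proof -
    have "ones_mat q q = ones_mat q 1 * (ones_mat 1 q :: int mat)" 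
      by (intro eq_matI) (auto simp: scalar_prod_def)
    moreover have "Q * (ones_mat q 1 * ones_mat 1 q) = Q * ones_mat q 1 * ones_mat 1 q"
      by (rule assoc_mult_mat[symmetric]) (use core(2) in auto)
    ultimately show Qj: "Q * ?j = 0\<^sub>m q q"
      by (simp add: core(7) left_mult_zero_mat[OF ones_mat_carrier] del: One_nat_def)
    have "transpose_mat (Q * ?j) = ?j * - Q"
      unfolding transpose_mult[OF core(2) ones_mat_carrier] core(5) transpose_ones_mat ..
    then show "?j * - Q = 0\<^sub>m q q" unfolding Qj by simp
  qed
  have cJ: "calJ q Q (Suc m) = kronecker ?j A" and cA: "calA q Q (Suc m) = kronecker ?I J + kronecker Q A"
    by (simp_all add: J_def A_def)
  have cJt: "transpose_mat (calJ q Q (Suc m)) = kronecker ?j (transpose_mat A)"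
    unfolding cJ kronecker_transpose by simp
  have cAt: "transpose_mat (calA q Q (Suc m)) = kronecker ?I (transpose_mat J) + kronecker (- Q) (transpose_mat A)"
    unfolding cA transpose_add[OF KQ(2,1)] kronecker_transpose core(5) by simp
  have c1: "kronecker ?I (transpose_mat J) \<in> carrier_mat (q * ?n) (q * ?n)"
    "kronecker (- Q) (transpose_mat A) \<in> carrier_mat (q * ?n) (q * ?n)"
    "kronecker ?j A \<in> carrier_mat (q * ?n) (q * ?n)"
    "kronecker ?j (transpose_mat A) \<in> carrier_mat (q * ?n) (q * ?n)"
    using nQ At Jt A by auto
  have JA: "calJ q Q (Suc m) * transpose_mat (calA q Q (Suc m)) = kronecker ?j (A * transpose_mat J)"
  proof -
    have "calJ q Q (Suc m) * transpose_mat (calA q Q (Suc m))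
        = kronecker ?j A * kronecker ?I (transpose_mat J) + kronecker ?j A * kronecker (- Q) (transpose_mat A)"
      unfolding cJ cAt by (rule mult_add_distrib_mat[OF c1(3,1,2)])
    also have "kronecker ?j A * kronecker ?I (transpose_mat J) = kronecker ?j (A * transpose_mat J)"
      by (simp add: kronecker_mult[OF ones_mat_carrier A one_carrier_mat Jt] right_mult_one_mat[OF ones_mat_carrier])
    also have "kronecker ?j A * kronecker (- Q) (transpose_mat A) = 0\<^sub>m (q * ?n) (q * ?n)"
      using A by (simp add: kronecker_mult[OF ones_mat_carrier A nQ At] jQ zero_kronecker[of _ ?n ?n])
    finally show ?thesis using A J by (simp add: right_add_zero_mat[OF kronecker_carrier])
  qed
  have AJ: "calA q Q (Suc m) * transpose_mat (calJ q Q (Suc m)) = kronecker ?j (J * transpose_mat A)"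
  proof -
    have "calA q Q (Suc m) * transpose_mat (calJ q Q (Suc m))
        = kronecker ?I J * kronecker ?j (transpose_mat A) + kronecker Q A * kronecker ?j (transpose_mat A)"
      unfolding cA cJt by (rule add_mult_distrib_mat[OF KQ(2,1) c1(4)])
    also have "kronecker ?I J * kronecker ?j (transpose_mat A) = kronecker ?j (J * transpose_mat A)"
      by (simp add: kronecker_mult[OF one_carrier_mat J ones_mat_carrier At] left_mult_one_mat[OF ones_mat_carrier])
    also have "kronecker Q A * kronecker ?j (transpose_mat A) = 0\<^sub>m (q * ?n) (q * ?n)"
      using A by (simp add: kronecker_mult[OF core(2) A ones_mat_carrier At] Qj zero_kronecker[of _ ?n ?n])
    finally show ?thesis using A J by (simp add: right_add_zero_mat[OF kronecker_carrier])
  qed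
  have JJ: "calJ q Q (Suc m) * transpose_mat (calJ q Q (Suc m)) = int q \<cdot>\<^sub>m kronecker ?j (A * transpose_mat A)"
    unfolding cJt unfolding cJ
    by (simp add: kronecker_mult[OF ones_mat_carrier A ones_mat_carrier At] ones_mat_mult kronecker_smult_left)
  have AA: "calA q Q (Suc m) * transpose_mat (calA q Q (Suc m))
      = kronecker ?I (J * transpose_mat J) + kronecker (Q * transpose_mat Q) (A * transpose_mat A)"
  proof -
    let ?a = "kronecker ?I J" and ?b = "kronecker Q A" and ?c = "kronecker ?I (transpose_mat J)"
      and ?d = "kronecker (- Q) (transpose_mat A)"
    have Qn: "1\<^sub>m q * - Q = - Q" "Q * 1\<^sub>m q = Q" using core(2) by auto
    have "calA q Q (Suc m) * transpose_mat (calA q Q (Suc m)) = (?a + ?b) * ?c + (?a + ?b) * ?d"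
      unfolding cAt unfolding cA by (rule mult_add_distrib_mat) (use KQ c1 in auto)
    also have "(?a + ?b) * ?c = ?a * ?c + ?b * ?c"
      by (rule add_mult_distrib_mat[OF KQ(2,1) c1(1)])
    also have "(?a + ?b) * ?d = ?a * ?d + ?b * ?d"
      by (rule add_mult_distrib_mat[OF KQ(2,1) c1(2)])
    also have "?a * ?c = kronecker ?I (J * transpose_mat J)"
      by (simp add: kronecker_mult[OF one_carrier_mat J one_carrier_mat Jt])
    also have "?b * ?c = kronecker Q (A * transpose_mat J)"
      by (simp add: kronecker_mult[OF core(2) A one_carrier_mat Jt] Qn)
    also have "?a * ?d = - kronecker Q (A * transpose_mat J)"
      unfolding kronecker_mult[OF one_carrier_mat J nQ At] by (simp add: Qn kronecker_uminus_left IH1)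
    also have "?b * ?d = kronecker (Q * transpose_mat Q) (A * transpose_mat A)"
      by (simp add: kronecker_mult[OF core(2) A nQ At] core(5))
    finally have *: "calA q Q (Suc m) * transpose_mat (calA q Q (Suc m)) =
        kronecker ?I (J * transpose_mat J) + kronecker Q (A * transpose_mat J)
        + (- kronecker Q (A * transpose_mat J) + kronecker (Q * transpose_mat Q) (A * transpose_mat A))" .
    have "kronecker ?I (J * transpose_mat J) \<in> carrier_mat (q * ?n) (q * ?n)"
      "kronecker Q (A * transpose_mat J) \<in> carrier_mat (q * ?n) (q * ?n)"
      "kronecker (Q * transpose_mat Q) (A * transpose_mat A) \<in> carrier_mat (q * ?n) (q * ?n)"
      using core(2) A J Jt At by (auto intro!: kronecker_carrier)
    then show ?thesis unfolding * by (intro eq_matI) auto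
  qed
  \<comment> \<open>The all-ones block contributed by \<open>calJ\<close> completes the Gram matrix
    of \<open>Q\<close> to \<open>q\<close> times the identity, after which the induction hypothesis
    applies to the second Kronecker factor.\<close>
  have "int q \<cdot>\<^sub>m kronecker ?j (A * transpose_mat A) + int q \<cdot>\<^sub>m
      (kronecker ?I (J * transpose_mat J) + kronecker (Q * transpose_mat Q) (A * transpose_mat A))
    = int q \<cdot>\<^sub>m kronecker ?I (J * transpose_mat J)
      + int q \<cdot>\<^sub>m kronecker (Q * transpose_mat Q + ?j) (A * transpose_mat A)"
  proof -
    have c: "kronecker ?I (J * transpose_mat J) \<in> carrier_mat (q * ?n) (q * ?n)"
      "kronecker ?j (A * transpose_mat A) \<in> carrier_mat (q * ?n) (q * ?n)"
      "kronecker (Q * transpose_mat Q) (A * transpose_mat A) \<in> carrier_mat (q * ?n) (q * ?n)"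
      using core(2) A J Jt At by (auto intro!: kronecker_carrier)
    have "kronecker (Q * transpose_mat Q + ?j) (A * transpose_mat A)
        = kronecker (Q * transpose_mat Q) (A * transpose_mat A) + kronecker ?j (A * transpose_mat A)"
      by (rule kronecker_add_left[where a = q and b = q]) (use core(2) in auto)
    then show ?thesis using c by (intro eq_matI) (auto simp: algebra_simps)
  qed
  also have "\<dots> = int q \<cdot>\<^sub>m kronecker ?I (J * transpose_mat J + int q \<cdot>\<^sub>m (A * transpose_mat A))"
  proof -
    have c: "J * transpose_mat J \<in> carrier_mat ?n ?n" "int q \<cdot>\<^sub>m (A * transpose_mat A) \<in> carrier_mat ?n ?n"
      using A J Jt At by auto
    have "kronecker ?I (J * transpose_mat J) \<in> carrier_mat (q * ?n) (q * ?n)"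
      "kronecker ?I (A * transpose_mat A) \<in> carrier_mat (q * ?n) (q * ?n)"
      using A J Jt At by (auto intro!: kronecker_carrier)
    then show ?thesis
      unfolding core(6) kronecker_add_right[OF c] kronecker_smult_left kronecker_smult_right
      by (intro eq_matI) (auto simp: algebra_simps)
  qed
  also have "\<dots> = int ((q + 1) * q ^ Suc m) \<cdot>\<^sub>m 1\<^sub>m (q ^ Suc m)"
    unfolding IH2 kronecker_smult_right kronecker_one
    by (intro eq_matI) (auto simp: algebra_simps)
  finally show ?case
    unfolding JA AJ IH1 JJ AA by simp
qed

text \<open>Since \<open>Q\<close> annihilates the all-ones vector, the pair of row sums passes from
  \<open>(a, b)\<close> to \<open>(q * b, a)\<close>, which multiplies \<open>a^2 + q * b^2\<close>
  by \<open>q\<close>. It starts at \<open>(1, 1)\<close>.\<close>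

lemma calJ_calA_row_sums:
  assumes Q: "skew_symmetric_core q Q"
  shows "\<exists>a b. calJ q Q m * ones_mat (q ^ m) 1 = a \<cdot>\<^sub>m ones_mat (q ^ m) 1 \<and>
    calA q Q m * ones_mat (q ^ m) 1 = b \<cdot>\<^sub>m ones_mat (q ^ m) 1 \<and>
    a\<^sup>2 + int q * b\<^sup>2 = int ((q + 1) * q ^ m)"
proof (induction m)
  case 0
  then show ?case by (intro exI[of _ 1]) (auto simp: ones_mat_mult)
next
  case (Suc m)
  note core = skew_symmetric_coreD[OF Q]
  let ?n = "q ^ m" and ?e = "ones_mat q 1 :: int mat" and ?f = "ones_mat (q ^ m) 1 :: int mat"
  define J A where "J = calJ q Q m" and "A = calA q Q m"
  have J: "J \<in> carrier_mat ?n ?n" and A: "A \<in> carrier_mat ?n ?n"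
    using calJ_calA_carrier[OF core(2)] by (auto simp: J_def A_def)
  obtain a b where a: "J * ?f = a \<cdot>\<^sub>m ?f" and b: "A * ?f = b \<cdot>\<^sub>m ?f"
    and ab: "a\<^sup>2 + int q * b\<^sup>2 = int ((q + 1) * ?n)"
    using Suc.IH by (auto simp: J_def A_def)
  have e: "ones_mat (q ^ Suc m) 1 = kronecker ?e ?f"
    by (simp add: kronecker_ones)
  have "calJ q Q (Suc m) * ones_mat (q ^ Suc m) 1 = kronecker (ones_mat q q * ?e) (A * ?f)"
    unfolding e calJ.simps A_def[symmetric]
    by (rule kronecker_mult[OF ones_mat_carrier A ones_mat_carrier ones_mat_carrier])
  also have "\<dots> = (int q * b) \<cdot>\<^sub>m ones_mat (q ^ Suc m) 1"
    unfolding b e ones_mat_mult kronecker_smult_right kronecker_smult_left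
    by (intro eq_matI) auto
  finally have 1: "calJ q Q (Suc m) * ones_mat (q ^ Suc m) 1 = (int q * b) \<cdot>\<^sub>m ones_mat (q ^ Suc m) 1" .
  have "calA q Q (Suc m) * ones_mat (q ^ Suc m) 1
      = kronecker (1\<^sub>m q) J * kronecker ?e ?f + kronecker Q A * kronecker ?e ?f"
    unfolding e calA.simps A_def[symmetric] J_def[symmetric]
    by (rule add_mult_distrib_mat[where nr = "q * ?n" and n = "q * ?n" and nc = "1 * 1"])
      (use core(2) A J kronecker_carrier[OF ones_mat_carrier[of q 1] ones_mat_carrier[of ?n 1]] in auto)
  also have "kronecker (1\<^sub>m q) J * kronecker ?e ?f = a \<cdot>\<^sub>m ones_mat (q ^ Suc m) 1"
    unfolding kronecker_mult[OF one_carrier_mat J ones_mat_carrier ones_mat_carrier] a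
      left_mult_one_mat[OF ones_mat_carrier] kronecker_smult_right e ..
  also have "kronecker Q A * kronecker ?e ?f = 0\<^sub>m (q ^ Suc m) 1"
    unfolding kronecker_mult[OF core(2) A ones_mat_carrier ones_mat_carrier] core(7) b
    by (subst zero_kronecker[of _ ?n 1]) auto
  finally have 2: "calA q Q (Suc m) * ones_mat (q ^ Suc m) 1 = a \<cdot>\<^sub>m ones_mat (q ^ Suc m) 1"
    by (simp add: right_add_zero_mat[of _ "q * ?n" 1])
  have "(int q * b)\<^sup>2 + int q * a\<^sup>2 = int q * (a\<^sup>2 + int q * b\<^sup>2)"
    by (simp add: algebra_simps power2_eq_square)
  also have "\<dots> = int ((q + 1) * q ^ Suc m)"
    unfolding ab by (simp add: algebra_simps)
  finally show ?case using 1 2 by blast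
qed

section \<open>Conjugate transposes and the unit Hadamard property\<close>

lemma mat_adjoint_carrier: "H \<in> carrier_mat n m \<Longrightarrow> mat_adjoint H \<in> carrier_mat m n"
  by (auto simp: mat_adjoint_def mat_of_rows_def)

lemma mat_adjoint_index:
  "i < dim_col H \<Longrightarrow> j < dim_row H \<Longrightarrow> mat_adjoint H $$ (i, j) = conjugate (H $$ (j, i))"
  by (simp add: mat_adjoint_def mat_of_rows_def)

lemma core_QUH_regular:
  assumes Q: "skew_symmetric_core q Q"
  shows "QUH (q ^ m) q (core_QUH q Q m) \<and> regular_unit_hadamard (q ^ m) (core_QUH q Q m) \<and>
    cmod (sum_mat (core_QUH q Q m)) = real q powr (3 * real m / 2)"
proof -
  note core = skew_symmetric_coreD[OF Q]
  define n where "n = q ^ m"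
  define J A where "J = calJ q Q m" and "A = calA q Q m"
  define H where "H = core_QUH q Q m"
  define c s where "c = complex_of_real (1 / sqrt (real q + 1))"
    and "s = complex_of_real (sqrt (real q / (real q + 1)))"
  have c2: "c * c * (of_nat q + 1) = 1" and s2: "s * s * (of_nat q + 1) = of_nat q"
  proof -
    have "1 / sqrt (real q + 1) * (1 / sqrt (real q + 1)) * (real q + 1) = 1" by simp
    then have "complex_of_real (1 / sqrt (real q + 1) * (1 / sqrt (real q + 1)) * (real q + 1)) = 1" by (metis of_real_1)
    then show "c * c * (of_nat q + 1) = 1" unfolding c_def of_real_mult by simp
    have "sqrt (real q / (real q + 1)) * sqrt (real q / (real q + 1)) * (real q + 1) = real q" by simp
    then have "complex_of_real (sqrt (real q / (real q + 1)) * sqrt (real q / (real q + 1)) * (real q + 1)) = of_nat q"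
      by (metis of_real_of_nat_eq)
    then show "s * s * (of_nat q + 1) = of_nat q" unfolding s_def of_real_mult by simp
  qed
  have q1: "complex_of_nat q + 1 \<noteq> 0" using of_nat_neq_0[of q, where 'a = complex] by (simp add: add.commute)
  \<comment> \<open>Serves twice: for signs \<open>x\<close> and \<open>y\<close> it gives entries
    of modulus 1, and for the row sums of \<open>J\<close> and \<open>A\<close> it gives
    regularity.\<close>
  have norm2: "(cmod (c * of_int x + \<i> * s * of_int y))\<^sup>2 * (real q + 1) = of_int (x\<^sup>2 + int q * y\<^sup>2)" for x y
  proof -
    have "(cmod (c * of_int x + \<i> * s * of_int y))\<^sup>2
        = (1 / sqrt (real q + 1) * x)\<^sup>2 + (sqrt (real q / (real q + 1)) * y)\<^sup>2"
      by (simp add: c_def s_def cmod_power2)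
    also have "\<dots> = (x\<^sup>2 + real q * y\<^sup>2) / (real q + 1)"
      by (simp add: power_mult_distrib power_divide add_divide_distrib)
    finally show ?thesis by (simp add: add_nonneg_eq_0_iff)
  qed
  have J: "J \<in> carrier_mat n n" and A: "A \<in> carrier_mat n n"
    using calJ_calA_carrier[OF core(2)] by (auto simp: J_def A_def n_def)
  have H: "H \<in> carrier_mat n n"
    using J A by (auto simp: H_def core_QUH_def J_def A_def)
  have Hij: "H $$ (i, j) = c * of_int (J $$ (i, j)) + \<i> * s * of_int (A $$ (i, j))"
    if "i < n" "j < n" for i j
    using J A that by (simp add: H_def core_QUH_def J_def A_def c_def s_def)
  have JA: "J $$ (i, j) \<in> {1, -1}" "A $$ (i, j) \<in> {1, -1}" if "i < n" "j < n" for i j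
    using calJ_calA_entries[OF Q] that by (auto simp: J_def A_def n_def)
  have entry_norm: "cmod h = 1" and entry_set: "h \<in> QUH_entries q" if "h \<in> elements_mat H" for h
  proof -
    from that H obtain i j where ij: "i < n" "j < n" and h: "h = H $$ (i, j)" by auto
    have "(J $$ (i, j))\<^sup>2 = 1" "(A $$ (i, j))\<^sup>2 = 1" using JA[OF ij] by auto
    then have "(cmod h)\<^sup>2 * (real q + 1) = real q + 1"
      unfolding h Hij[OF ij] norm2 by simp
    then show "cmod h = 1" by (simp add: power2_eq_1_iff add_nonneg_eq_0_iff)
       (metis norm_ge_zero less_eq_real_def one_neq_neg_one not_one_le_zero neg_0_le_iff_le)
    have "of_int (J $$ (i, j)) \<in> {1, -1 :: complex}" "of_int (A $$ (i, j)) \<in> {1, -1 :: complex}"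
      using JA[OF ij] by auto
    moreover have "h = of_int (J $$ (i, j)) * c + of_int (A $$ (i, j)) * \<i> * s"
      unfolding h Hij[OF ij] by (simp add: algebra_simps)
    ultimately show "h \<in> QUH_entries q"
      unfolding QUH_entries_def c_def s_def by blast
  qed
  have gram: "calJ q Q m * transpose_mat (calA q Q m) = calA q Q m * transpose_mat (calJ q Q m)"
    "calJ q Q m * transpose_mat (calJ q Q m) + int q \<cdot>\<^sub>m (calA q Q m * transpose_mat (calA q Q m))
      = int ((q + 1) * q ^ m) \<cdot>\<^sub>m 1\<^sub>m (q ^ m)"
    using calJ_calA_gram[OF Q] by auto
  have HH: "H * mat_adjoint H = of_nat n \<cdot>\<^sub>m 1\<^sub>m n"
  proof (rule eq_matI)
    fix i j assume "i < dim_row (of_nat n \<cdot>\<^sub>m 1\<^sub>m n :: complex mat)" "j < dim_col (of_nat n \<cdot>\<^sub>m 1\<^sub>m n :: complex mat)"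
    then have ij: "i < n" "j < n" by auto
    define jj ja aj aa where "jj = (\<Sum>l<n. J $$ (i, l) * J $$ (j, l))" and "ja = (\<Sum>l<n. J $$ (i, l) * A $$ (j, l))"
      and "aj = (\<Sum>l<n. A $$ (i, l) * J $$ (j, l))" and "aa = (\<Sum>l<n. A $$ (i, l) * A $$ (j, l))"
    have "ja = (J * transpose_mat A) $$ (i, j)" "aj = (A * transpose_mat J) $$ (i, j)"
      using ij J A by (simp_all add: ja_def aj_def scalar_prod_def lessThan_atLeast0)
    then have ja: "ja = aj" using gram(1) by (simp add: J_def A_def)
    have "jj + int q * aa = (J * transpose_mat J + int q \<cdot>\<^sub>m (A * transpose_mat A)) $$ (i, j)"
      using ij J A by (simp add: jj_def aa_def scalar_prod_def lessThan_atLeast0)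
    also have "\<dots> = (if i = j then int ((q + 1) * n) else 0)"
      unfolding J_def A_def gram(2) using ij by (simp add: n_def)
    finally have jj: "jj + int q * aa = (if i = j then int ((q + 1) * n) else 0)" .
    have "(H * mat_adjoint H) $$ (i, j) = (\<Sum>l<n. H $$ (i, l) * cnj (H $$ (j, l)))"
      using ij H mat_adjoint_carrier[OF H]
      by (simp add: scalar_prod_def lessThan_atLeast0 mat_adjoint_index)
    \<comment> \<open>The cross terms carry \<open>\<i> * c * s\<close> with opposite signs, so that
      \<open>ja = aj\<close> cancels them.\<close>
    also have "\<dots> = (\<Sum>l<n. c * c * of_int (J $$ (i, l) * J $$ (j, l)) + s * s * of_int (A $$ (i, l) * A $$ (j, l))
        + \<i> * c * s * of_int (A $$ (i, l) * J $$ (j, l)) - \<i> * c * s * of_int (J $$ (i, l) * A $$ (j, l)))"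
      by (intro sum.cong refl) (use ij Hij in \<open>simp add: algebra_simps c_def s_def\<close>)
    also have "\<dots> = c * c * of_int jj + s * s * of_int aa + \<i> * c * s * of_int aj - \<i> * c * s * of_int ja"
      by (simp add: sum.distrib sum_subtractf sum_distrib_left jj_def ja_def aa_def aj_def)
    finally have HHij: "(H * mat_adjoint H) $$ (i, j) = c * c * of_int jj + s * s * of_int aa" by (simp add: ja)
    have "(c * c * of_int jj + s * s * of_int aa) * (of_nat q + 1)
        = c * c * (of_nat q + 1) * of_int jj + s * s * (of_nat q + 1) * of_int aa"
      by (simp add: algebra_simps)
    also have "\<dots> = of_int (jj + int q * aa)"
      unfolding c2 s2 by simp
    also have "\<dots> = (of_nat n \<cdot>\<^sub>m 1\<^sub>m n) $$ (i, j) * (of_nat q + 1)"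
      unfolding jj using ij by (simp add: algebra_simps)
    finally show "(H * mat_adjoint H) $$ (i, j) = (of_nat n \<cdot>\<^sub>m 1\<^sub>m n) $$ (i, j)"
      using HHij q1 by simp
  qed (use H mat_adjoint_carrier[OF H] in auto)
  have uh: "unit_hadamard n H"
    using H entry_norm HH by (auto simp: unit_hadamard_def)
  obtain a b where a: "J * ones_mat n 1 = a \<cdot>\<^sub>m ones_mat n 1" and b: "A * ones_mat n 1 = b \<cdot>\<^sub>m ones_mat n 1"
    and ab: "a\<^sup>2 + int q * b\<^sup>2 = int ((q + 1) * n)"
    using calJ_calA_row_sums[OF Q, of m] by (auto simp: J_def A_def n_def)
  define r where "r = c * of_int a + \<i> * s * of_int b"
  have rows: "(\<Sum>j<n. H $$ (i, j)) = r" if i: "i < n" for i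
  proof -
    have "(\<Sum>j<n. J $$ (i, j)) = (J * ones_mat n 1) $$ (i, 0)" "(\<Sum>j<n. A $$ (i, j)) = (A * ones_mat n 1) $$ (i, 0)"
      using i J A by (simp_all add: scalar_prod_def lessThan_atLeast0)
    then have *: "(\<Sum>j<n. J $$ (i, j)) = a" "(\<Sum>j<n. A $$ (i, j)) = b"
      using i by (simp_all add: a b del: One_nat_def)
    have "(\<Sum>j<n. H $$ (i, j)) = c * of_int (\<Sum>j<n. J $$ (i, j)) + \<i> * s * of_int (\<Sum>j<n. A $$ (i, j))"
      using i by (simp add: Hij sum.distrib sum_distrib_left)
    then show ?thesis unfolding * r_def .
  qed
  have "(cmod r)\<^sup>2 * (real q + 1) = real n * (real q + 1)"
    unfolding r_def norm2 ab by (simp add: algebra_simps)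
  then have "(cmod r)\<^sup>2 = real n" by (simp add: add_nonneg_eq_0_iff)
  then have r: "cmod r = sqrt (real n)" by (metis norm_ge_zero real_sqrt_unique)
  have reg: "regular_unit_hadamard n H"
    using uh rows r by (simp add: regular_unit_hadamard_def)
  \<comment> \<open>The row sums agree as complex numbers, not only in modulus, so they add up
    without cancellation.\<close>
  have "sum_mat H = (\<Sum>i<n. \<Sum>j<n. H $$ (i, j))"
    using H by (simp add: sum_mat_def sum.cartesian_product lessThan_atLeast0)
  also have "\<dots> = of_nat n * r" using rows by simp
  finally have "cmod (sum_mat H) = real n * sqrt (real n)" by (simp add: norm_mult r)
  also have "\<dots> = real q powr (real m) * (real q powr real m) powr (1 / 2)"
    using core(1) by (simp add: n_def powr_realpow powr_half_sqrt)
  also have "\<dots> = real q powr (3 * real m / 2)"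
    using core(1) by (simp add: powr_powr powr_add[symmetric])
  finally have "cmod (sum_mat H) = real q powr (3 * real m / 2)" .
  then show ?thesis
    using uh reg entry_set core(1) by (auto simp: QUH_def H_def n_def)
qed

section \<open>Digitwise differences and multicirculant matrices\<close>

text \<open>Borrow-free subtraction \<open>j - i\<close> of \<open>N\<close>-digit numbers in base \<open>p\<close>, with the summand \<open>p\<close> against
  truncation as in \<open>block_circ\<close>; junk unless \<open>i, j < p ^ N\<close>.\<close>

fun digit_diff :: "nat \<Rightarrow> nat \<Rightarrow> nat \<Rightarrow> nat \<Rightarrow> nat" where
  "digit_diff p 0 i j = 0"
| "digit_diff p (Suc N) i j =
     p ^ N * ((p + j div p ^ N - i div p ^ N) mod p) + digit_diff p N (i mod p ^ N) (j mod p ^ N)"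

lemma digit_diff_less: "0 < p \<Longrightarrow> digit_diff p N i j < p ^ N"
proof (induction N arbitrary: i j)
  case (Suc N)
  let ?r = "(p + j div p ^ N - i div p ^ N) mod p"
  have "digit_diff p (Suc N) i j < p ^ N * ?r + p ^ N" using Suc by simp
  also have "\<dots> = p ^ N * Suc ?r" by simp
  also have "\<dots> \<le> p ^ N * p" by (intro mult_left_mono) (use Suc.prems in \<open>simp_all add: Suc_leI\<close>)
  finally show ?case by (simp add: mult.commute)
qed simp

text \<open>The top \<open>a\<close> digits and the low \<open>b\<close> digits do not interact
  because nothing is borrowed. They correspond to the block index and the inner index of a Kronecker
  product.\<close>

lemma digit_diff_append:
  assumes "0 < p"
  shows "i < p ^ (a + b) \<Longrightarrow> j < p ^ (a + b) \<Longrightarrow>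
    digit_diff p (a + b) i j
    = p ^ b * digit_diff p a (i div p ^ b) (j div p ^ b) + digit_diff p b (i mod p ^ b) (j mod p ^ b)"
proof (induction a arbitrary: i j)
  case (Suc a)
  have d: "x mod p ^ (a + b) div p ^ b = x div p ^ b mod p ^ a" "x mod p ^ (a + b) mod p ^ b = x mod p ^ b"
    "x div p ^ (a + b) = x div p ^ b div p ^ a" for x
    using assms by (simp_all add: power_add mult.commute[of "p ^ a"] mod_mult2_eq div_mult2_eq)
  show ?case
    using assms by (simp add: Suc.IH d) (simp add: power_add algebra_simps)
qed simp

lemma mod_diff_eq_0_iff:
  assumes "x < p" "y < (p :: nat)"
  shows "(p + y - x) mod p = 0 \<longleftrightarrow> x = y"
proof
  assume "(p + y - x) mod p = 0"
  then have "(p + y) mod p = x mod p"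
    using assms by (metis le_add1 less_imp_le mod_if add_0 le_add_diff_inverse2 mod_add_left_eq le_trans)
  then show "x = y" using assms by simp
qed (use assms in auto)

text \<open>Makes the identity matrix a function of the digit difference, as the recursion for
  \<open>calA\<close> requires, and reduces injectivity of digit coordinates to a trivial
  kernel.\<close>

lemma digit_diff_eq_0_iff:
  "0 < p \<Longrightarrow> i < p ^ N \<Longrightarrow> j < p ^ N \<Longrightarrow> digit_diff p N i j = 0 \<longleftrightarrow> i = j"
proof (induction N arbitrary: i j)
  case (Suc N)
  have "i div p ^ N < p" "j div p ^ N < p"
    using Suc.prems by (auto simp: less_mult_imp_div_less)
  then have "digit_diff p (Suc N) i j = 0 \<longleftrightarrow> i div p ^ N = j div p ^ N \<and> i mod p ^ N = j mod p ^ N"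
    using Suc by (simp add: mod_diff_eq_0_iff)
  then show ?case by (metis div_mult_mod_eq)
qed simp

text \<open>The leading digit of the difference selects one of \<open>p\<close> blocks, and within a
  block the entry depends on the remaining digits only. The function \<open>f\<close> varies in the
  induction, since each block has its own.\<close>

lemma multicirculant_digit_diff:
  assumes "2 \<le> p" "M \<in> carrier_mat (p ^ N) (p ^ N)"
    "\<And>i j. i < p ^ N \<Longrightarrow> j < p ^ N \<Longrightarrow> M $$ (i, j) = f (digit_diff p N i j)"
  shows "multicirculant M"
  using assms(2,3)
proof (induction N arbitrary: M f)
  case 0
  then show ?case by (auto intro: multicirculant.order_one)
next
  case (Suc N)
  define s where "s = p ^ N"
  \<comment> \<open>\<open>B r\<close> is the block at leading digit difference \<open>r\<close>; it
    is governed by \<open>f\<close> shifted by \<open>s * r\<close>.\<close>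
  define B where "B r = mat s s (\<lambda>(i, j). f (s * r + digit_diff p N i j))" for r
  have s: "0 < s" and p: "0 < p" using assms(1) by (auto simp: s_def)
  have B: "B r \<in> carrier_mat s s" "multicirculant (B r)" for r
    using Suc.IH[of "B r" "\<lambda>x. f (s * r + x)"] by (auto simp: B_def s_def)
  have "M = block_circ s (map B [0..<p])"
  proof (rule eq_matI)
    fix i j assume "i < dim_row (block_circ s (map B [0..<p]))" "j < dim_col (block_circ s (map B [0..<p]))"
    then have ij: "i < p * s" "j < p * s" by (auto simp: block_circ_def Let_def)
    have "block_circ s (map B [0..<p]) $$ (i, j)
        = B ((p + j div s - i div s) mod p) $$ (i mod s, j mod s)"
      using ij p by (simp add: block_circ_def Let_def)
    also have "\<dots> = f (digit_diff p (Suc N) i j)"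
      using s by (simp add: B_def s_def)
    finally show "M $$ (i, j) = block_circ s (map B [0..<p]) $$ (i, j)"
      using Suc.prems(2)[of i j] ij by (simp add: s_def)
  qed (use Suc.prems(1) in \<open>auto simp: block_circ_def Let_def s_def\<close>)
  moreover have "multicirculant (block_circ s (map B [0..<p]))"
    using assms(1) B by (intro multicirculant.block) auto
  ultimately show ?case by simp
qed

text \<open>A matrix of order \<open>p ^ (k * m)\<close> has indices with \<open>k * m\<close>
  digits. Passing from \<open>m\<close> to \<open>m + 1\<close> prepends the \<open>k\<close> digits
  that index the blocks, on which both the identity and \<open>Q\<close> depend through their
  difference.\<close>

lemma calJ_calA_digit_diff:
  assumes p: "0 < p" and Q: "Q \<in> carrier_mat (p ^ k) (p ^ k)"
    and g: "\<And>i j. i < p ^ k \<Longrightarrow> j < p ^ k \<Longrightarrow> Q $$ (i, j) = g (digit_diff p k i j)"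
  shows "\<exists>f h. \<forall>i < p ^ (k * m). \<forall>j < p ^ (k * m).
    calJ (p ^ k) Q m $$ (i, j) = f (digit_diff p (k * m) i j) \<and>
    calA (p ^ k) Q m $$ (i, j) = h (digit_diff p (k * m) i j)"
proof (induction m)
  case 0
  show ?case by (intro exI[of _ "\<lambda>_. 1"]) simp
next
  case (Suc m)
  define n where "n = p ^ (k * m)"
  define J A where "J = calJ (p ^ k) Q m" and "A = calA (p ^ k) Q m"
  have n: "0 < n" using p by (simp add: n_def)
  have J: "J \<in> carrier_mat n n" and A: "A \<in> carrier_mat n n"
    using calJ_calA_carrier[OF Q, of m] by (auto simp: J_def A_def n_def power_mult)
  obtain f h where fh: "J $$ (i, j) = f (digit_diff p (k * m) i j)" "A $$ (i, j) = h (digit_diff p (k * m) i j)"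
    if "i < n" "j < n" for i j
    using Suc.IH unfolding J_def A_def n_def by blast
  define f' where "f' d = h (d mod n)" for d
  \<comment> \<open>\<open>d div n\<close> is the difference of the block indices, and it is 0
    exactly on the diagonal blocks.\<close>
  define h' where "h' d = (if d div n = 0 then f (d mod n) else 0) + g (d div n) * h (d mod n)" for d
  have "calJ (p ^ k) Q (Suc m) $$ (i, j) = f' (digit_diff p (k * Suc m) i j) \<and>
    calA (p ^ k) Q (Suc m) $$ (i, j) = h' (digit_diff p (k * Suc m) i j)"
    if ij: "i < p ^ (k * Suc m)" "j < p ^ (k * Suc m)" for i j
  proof -
    let ?i1 = "i div n" and ?i2 = "i mod n" and ?j1 = "j div n" and ?j2 = "j mod n"
    have ij': "i < p ^ k * n" "j < p ^ k * n" using ij by (simp_all add: n_def power_add)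
    then have 1: "?i1 < p ^ k" "?j1 < p ^ k" and 2: "?i2 < n" "?j2 < n"
      using n by (auto simp: less_mult_imp_div_less)
    have D: "digit_diff p (k * Suc m) i j = n * digit_diff p k ?i1 ?j1 + digit_diff p (k * m) ?i2 ?j2"
      using digit_diff_append[OF p, of i k "k * m" j] ij by (simp add: n_def)
    have less: "digit_diff p (k * m) ?i2 ?j2 < n" using digit_diff_less[OF p] by (simp add: n_def)
    have Dd: "digit_diff p (k * Suc m) i j div n = digit_diff p k ?i1 ?j1"
      "digit_diff p (k * Suc m) i j mod n = digit_diff p (k * m) ?i2 ?j2"
      unfolding D using less n by auto
    have "calJ (p ^ k) Q (Suc m) $$ (i, j) = h (digit_diff p (k * m) ?i2 ?j2)"
      using 1 2 fh(2) by (simp add: J_def[symmetric] A_def[symmetric] kronecker_index[OF ones_mat_carrier A ij'])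
    moreover have "calA (p ^ k) Q (Suc m) $$ (i, j)
        = kronecker (1\<^sub>m (p ^ k)) J $$ (i, j) + kronecker Q A $$ (i, j)"
      using kronecker_carrier[OF Q A] ij' by (simp add: J_def[symmetric] A_def[symmetric])
    moreover have "\<dots> = (if digit_diff p k ?i1 ?j1 = 0 then f (digit_diff p (k * m) ?i2 ?j2) else 0)
        + g (digit_diff p k ?i1 ?j1) * h (digit_diff p (k * m) ?i2 ?j2)"
      using 1 2 fh g digit_diff_eq_0_iff[OF p 1]
      by (simp add: kronecker_index[OF one_carrier_mat J ij'] kronecker_index[OF Q A ij'])
    ultimately show ?thesis unfolding f'_def h'_def Dd by simp
  qed
  then show ?case by blast
qed

lemma multicirculant_core_QUH:
  assumes p: "2 \<le> p" and Q: "Q \<in> carrier_mat (p ^ k) (p ^ k)"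
    and g: "\<And>i j. i < p ^ k \<Longrightarrow> j < p ^ k \<Longrightarrow> Q $$ (i, j) = g (digit_diff p k i j)"
  shows "multicirculant (core_QUH (p ^ k) Q m)"
proof -
  have p0: "0 < p" using p by simp
  obtain f h where fh: "\<forall>i < p ^ (k * m). \<forall>j < p ^ (k * m).
    calJ (p ^ k) Q m $$ (i, j) = f (digit_diff p (k * m) i j) \<and>
    calA (p ^ k) Q m $$ (i, j) = h (digit_diff p (k * m) i j)"
    using calJ_calA_digit_diff[OF p0 Q g] by blast
  have JA: "calJ (p ^ k) Q m \<in> carrier_mat (p ^ (k * m)) (p ^ (k * m))"
    "calA (p ^ k) Q m \<in> carrier_mat (p ^ (k * m)) (p ^ (k * m))"
    using calJ_calA_carrier[OF Q, of m] by (auto simp: power_mult)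
  define F where "F d = complex_of_real (1 / sqrt (real (p ^ k) + 1)) * of_int (f d)
    + (\<i> * complex_of_real (sqrt (real (p ^ k) / (real (p ^ k) + 1)))) * of_int (h d)" for d
  show ?thesis
  proof (rule multicirculant_digit_diff[OF p])
    show "core_QUH (p ^ k) Q m \<in> carrier_mat (p ^ (k * m)) (p ^ (k * m))"
      using JA by (simp add: core_QUH_def)
    show "core_QUH (p ^ k) Q m $$ (i, j) = F (digit_diff p (k * m) i j)"
      if "i < p ^ (k * m)" "j < p ^ (k * m)" for i j
      using that JA fh by (simp add: core_QUH_def F_def)
  qed
qed

section \<open>Recognising a core by its row sums and row products\<close>

lemma skew_symmetric_coreI:
  assumes q: "0 < q" and Q: "Q \<in> carrier_mat q q"
    and diag: "\<And>i. i < q \<Longrightarrow> Q $$ (i, i) = 0"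
    and off: "\<And>i j. i < q \<Longrightarrow> j < q \<Longrightarrow> i \<noteq> j \<Longrightarrow> Q $$ (i, j) \<in> {1, -1}"
    and skew: "\<And>i j. i < q \<Longrightarrow> j < q \<Longrightarrow> Q $$ (j, i) = - Q $$ (i, j)"
    and row: "\<And>i. i < q \<Longrightarrow> (\<Sum>l<q. Q $$ (i, l)) = 0"
    and orth: "\<And>i j. i < q \<Longrightarrow> j < q \<Longrightarrow> i \<noteq> j \<Longrightarrow> (\<Sum>l<q. Q $$ (i, l) * Q $$ (j, l)) = -1"
  shows "skew_symmetric_core q Q"
proof -
  define H :: "int mat" where "H = four_block_mat (ones_mat 1 1) (ones_mat 1 q)
          (- transpose_mat (ones_mat 1 q)) (1\<^sub>m q + Q)"
  define W where "W = H - 1\<^sub>m (q + 1)"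
  have H: "H \<in> carrier_mat (q + 1) (q + 1)" using Q by (auto simp: H_def)
  then have W: "W \<in> carrier_mat (q + 1) (q + 1)" by (auto simp: W_def)
  have h: "H $$ (Suc i, Suc j) = (if i = j then 1 else 0) + Q $$ (i, j)" if "i < q" "j < q" for i j
    using that Q by (simp add: H_def)
  have h0: "H $$ (0, j) = 1" if "j < q + 1" for j
    using that Q q by (simp add: H_def)
  have h1: "H $$ (Suc i, 0) = -1" if "i < q" for i
    using that Q by (simp add: H_def)
  have entries: "H $$ (i, j) \<in> {1, -1}" if "i < q + 1" "j < q + 1" for i j
    using that h0[of j] h1[of "i - 1"] h[of "i - 1" "j - 1"] off[of "i - 1" "j - 1"] diag[of "i - 1"]
    by (cases i; cases j) (auto split: if_splits)
  have Wskew: "transpose_mat W = - W"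
  proof (rule eq_matI)
    fix i j assume "i < dim_row (- W)" "j < dim_col (- W)"
    then have ij: "i < q + 1" "j < q + 1" using W by auto
    show "transpose_mat W $$ (i, j) = (- W) $$ (i, j)"
      using ij H h0[of i] h0[of j] h1[of "i - 1"] h1[of "j - 1"] h[of "i - 1" "j - 1"] h[of "j - 1" "i - 1"]
        skew[of "i - 1" "j - 1"]
      by (cases i; cases j) (auto simp: W_def)
  qed (use W in auto)
  \<comment> \<open>The diagonal of the Gram matrix comes from the entries being signs;
    \<open>row\<close> and \<open>orth\<close> govern the products of distinct rows.\<close>
  have diagsum: "(\<Sum>l<q+1. H $$ (i, l) * H $$ (i, l)) = int (q + 1)" if "i < q + 1" for i
  proof -
    have "(\<Sum>l<q+1. H $$ (i, l) * H $$ (i, l)) = (\<Sum>l<q+1. 1)"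
      by (intro sum.cong refl) (use entries[OF that] in fastforce)
    then show ?thesis by simp
  qed
  have s0: "(\<Sum>l<q+1. H $$ (0, l) * H $$ (Suc i, l)) = 0" if i: "i < q" for i
  proof -
    \<comment> \<open>The border contributes -1, which the diagonal entry of \<open>I + Q\<close>
      compensates.\<close>
    have "(\<Sum>l<q+1. H $$ (0, l) * H $$ (Suc i, l)) = -1 + (\<Sum>l<q. H $$ (Suc i, Suc l))"
      using i by (simp add: sum.lessThan_Suc_shift h0 h1 del: sum.lessThan_Suc)
    also have "(\<Sum>l<q. H $$ (Suc i, Suc l)) = (\<Sum>l<q. (if i = l then 1 else 0) + Q $$ (i, l))"
      by (intro sum.cong refl) (simp add: h i)
    also have "\<dots> = 1" using i row by (simp add: sum.distrib)
    finally show ?thesis by simp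
  qed
  have s1: "(\<Sum>l<q+1. H $$ (Suc i, l) * H $$ (Suc j, l)) = 0" if ij: "i < q" "j < q" "i \<noteq> j" for i j
  proof -
    have "(\<Sum>l<q+1. H $$ (Suc i, l) * H $$ (Suc j, l))
        = 1 + (\<Sum>l<q. H $$ (Suc i, Suc l) * H $$ (Suc j, Suc l))"
      using ij by (simp add: sum.lessThan_Suc_shift h1 del: sum.lessThan_Suc)
    \<comment> \<open>As in the converse direction, the terms \<open>Q $$ (j, i)\<close> and
      \<open>Q $$ (i, j)\<close> cancel; the border's 1 offsets the -1 of
      \<open>orth\<close>.\<close>
    also have "(\<Sum>l<q. H $$ (Suc i, Suc l) * H $$ (Suc j, Suc l))
        = (\<Sum>l<q. (if l = i then Q $$ (j, l) else 0)
             + (if l = j then Q $$ (i, l) else 0) + Q $$ (i, l) * Q $$ (j, l))"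
      by (intro sum.cong refl) (use ij in \<open>auto simp: h algebra_simps\<close>)
    also have "\<dots> = Q $$ (j, i) + Q $$ (i, j) + (\<Sum>l<q. Q $$ (i, l) * Q $$ (j, l))"
      using ij by (simp add: sum.distrib)
    finally show ?thesis using skew[OF ij(1,2)] orth[OF ij] by simp
  qed
  have HH: "H * transpose_mat H = int (q + 1) \<cdot>\<^sub>m 1\<^sub>m (q + 1)"
  proof (rule eq_matI)
    fix i j assume "i < dim_row (int (q + 1) \<cdot>\<^sub>m 1\<^sub>m (q + 1) :: int mat)" "j < dim_col (int (q + 1) \<cdot>\<^sub>m 1\<^sub>m (q + 1) :: int mat)"
    then have ij: "i < q + 1" "j < q + 1" by auto
    have "(H * transpose_mat H) $$ (i, j) = (\<Sum>l<q+1. H $$ (i, l) * H $$ (j, l))"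
      using H ij by (simp add: scalar_prod_def lessThan_atLeast0)
    also have "\<dots> = (if i = j then int (q + 1) else 0)"
    proof (cases "i = j")
      case True
      then show ?thesis using diagsum[OF ij(1)] by (simp del: sum.lessThan_Suc)
    next
      case False
      have "(\<Sum>l<q+1. H $$ (i, l) * H $$ (j, l)) = (\<Sum>l<q+1. H $$ (j, l) * H $$ (i, l))"
        by (simp only: mult.commute)
      then show ?thesis using False ij s0[of "j - 1"] s0[of "i - 1"] s1[of "i - 1" "j - 1"]
        by (cases i; cases j) (simp_all del: sum.lessThan_Suc)
    qed
    finally show "(H * transpose_mat H) $$ (i, j) = (int (q + 1) \<cdot>\<^sub>m 1\<^sub>m (q + 1)) $$ (i, j)"
      using ij by simp
  qed (use H in auto)
  have "elements_mat W \<subseteq> {0, 1, -1}"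
  proof
    fix w assume "w \<in> elements_mat W"
    then obtain i j where ij: "i < q + 1" "j < q + 1" and w: "w = W $$ (i, j)"
      using elements_matD W by (metis carrier_matD)
    have "W $$ (i, i) = 0" if "i < q + 1" for i
      using that H h0[of 0] h[of "i - 1" "i - 1"] diag[of "i - 1"] by (cases i) (auto simp: W_def)
    moreover have "W $$ (i, j) = H $$ (i, j)" if "i \<noteq> j"
      using that ij H by (simp add: W_def)
    ultimately show "w \<in> {0, 1, -1}" using entries[OF ij] ij w by (cases "i = j") auto
  qed
  moreover have "H = 1\<^sub>m (q + 1) + W"
    by (rule eq_matI) (use H in \<open>auto simp: W_def\<close>)
  moreover have "elements_mat H \<subseteq> {1, -1}"
  proof
    fix x assume "x \<in> elements_mat H"
    then obtain i j where "i < q + 1" "j < q + 1" "x = H $$ (i, j)"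
      using elements_matD H by (metis carrier_matD)
    then show "x \<in> {1, -1}" using entries by simp
  qed
  ultimately have "skew_type_hadamard (q + 1) H"
    unfolding skew_type_hadamard_def hadamard_def using H W HH Wskew by auto
  then show ?thesis
    unfolding skew_symmetric_core_def H_def using q Q by simp
qed

section \<open>Congruences modulo a prime ideal\<close>

text \<open>Ring and ideal are sets in an ambient ring, so no quotient type arises. Primality of
  \<open>M\<close> plays the part of the absence of zero divisors in the residue ring.\<close>

locale prime_ideal_of_subring =
  fixes R M :: "'a :: comm_ring_1 set"
  assumes one_R: "1 \<in> R"
    and add_R: "x \<in> R \<Longrightarrow> y \<in> R \<Longrightarrow> x + y \<in> R"
    and uminus_R: "x \<in> R \<Longrightarrow> - x \<in> R"
    and mult_R: "x \<in> R \<Longrightarrow> y \<in> R \<Longrightarrow> x * y \<in> R"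
    and M_R: "M \<subseteq> R"
    and zero_M: "0 \<in> M"
    and add_M: "x \<in> M \<Longrightarrow> y \<in> M \<Longrightarrow> x + y \<in> M"
    and mult_M: "x \<in> R \<Longrightarrow> y \<in> M \<Longrightarrow> x * y \<in> M"
    and one_M: "1 \<notin> M"
    and prime_M: "x \<in> R \<Longrightarrow> y \<in> R \<Longrightarrow> x * y \<in> M \<Longrightarrow> x \<in> M \<or> y \<in> M"
begin

lemma zero_R: "0 \<in> R" using M_R zero_M by blast

lemma diff_R: "x \<in> R \<Longrightarrow> y \<in> R \<Longrightarrow> x - y \<in> R"
  using add_R[OF _ uminus_R] by simp

lemma power_R: "x \<in> R \<Longrightarrow> x ^ n \<in> R"
  by (induction n) (auto intro: one_R mult_R)

lemma of_nat_R: "of_nat n \<in> R"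
  by (induction n) (auto intro: one_R zero_R add_R)

lemma of_int_R: "of_int n \<in> R"
  by (cases n rule: int_cases2) (auto intro: of_nat_R uminus_R)

lemmas R_closed = zero_R one_R add_R uminus_R mult_R diff_R power_R of_nat_R of_int_R

lemma uminus_M: "x \<in> M \<Longrightarrow> - x \<in> M"
  using mult_M[OF uminus_R[OF one_R]] by simp

lemma diff_M: "x \<in> M \<Longrightarrow> y \<in> M \<Longrightarrow> x - y \<in> M"
  using add_M[OF _ uminus_M] by simp

text \<open>Membership in \<open>R\<close> is built in, so that congruences can be chained and
  multiplied without side conditions.\<close>

definition cg :: "'a \<Rightarrow> 'a \<Rightarrow> bool" where
  "cg x y \<longleftrightarrow> x \<in> R \<and> y \<in> R \<and> x - y \<in> M"

lemma cg_refl: "x \<in> R \<Longrightarrow> cg x x"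
  by (simp add: cg_def zero_M)

lemma cg_sym: "cg x y \<Longrightarrow> cg y x"
  unfolding cg_def using uminus_M[of "x - y"] by simp

lemma cg_trans [trans]: "cg x y \<Longrightarrow> cg y z \<Longrightarrow> cg x z"
  unfolding cg_def using add_M[of "x - y" "y - z"] by simp

lemma cg_add: "cg x y \<Longrightarrow> cg z w \<Longrightarrow> cg (x + z) (y + w)"
  unfolding cg_def using add_M[of "x - y" "z - w"] by (simp add: add_R algebra_simps)

lemma cg_uminus: "cg x y \<Longrightarrow> cg (- x) (- y)"
  unfolding cg_def using uminus_M[of "x - y"] by (simp add: uminus_R)

lemma cg_diff: "cg x y \<Longrightarrow> cg z w \<Longrightarrow> cg (x - z) (y - w)"
  using cg_add[OF _ cg_uminus] by simp

lemma cg_mult: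
  assumes "cg x y" "cg z w" shows "cg (x * z) (y * w)"
proof -
  have "z * (x - y) + y * (z - w) \<in> M"
    using assms by (auto simp: cg_def intro: add_M mult_M)
  then show ?thesis using assms by (auto simp: cg_def mult_R algebra_simps)
qed

lemma cg_power: "cg x y \<Longrightarrow> cg (x ^ n) (y ^ n)"
  by (induction n) (auto intro: cg_refl one_R cg_mult)

lemma cg_0_iff: "cg x 0 \<longleftrightarrow> x \<in> M"
  using M_R by (auto simp: cg_def zero_R)

lemma power_M_iff: "x \<in> R \<Longrightarrow> x ^ n \<in> M \<Longrightarrow> x \<in> M"
  by (induction n) (use one_M prime_M power_R in auto)

text \<open>Primality for finite products. Membership of the product in \<open>R\<close> is proved
  along with it, because \<open>prime_M\<close> asks for it at each step.\<close>

lemma prod_M: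
  "finite S \<Longrightarrow> (\<And>s. s \<in> S \<Longrightarrow> f s \<in> R) \<Longrightarrow> (\<Prod>s\<in>S. f s) \<in> R \<and>
    ((\<Prod>s\<in>S. f s) \<in> M \<longleftrightarrow> (\<exists>s\<in>S. f s \<in> M))"
proof (induction S rule: finite_induct)
  case empty
  then show ?case by (simp add: one_R one_M)
next
  case (insert s S)
  have "f s * prod f S \<in> M \<longleftrightarrow> f s \<in> M \<or> prod f S \<in> M"
    using insert prime_M[of "f s" "prod f S"] mult_M[of "f s" "prod f S"] mult_M[of "prod f S" "f s"]
    by (auto simp: mult.commute)
  then show ?case using insert by (auto intro: mult_R)
qed

lemma sum_M: "(\<And>s. s \<in> S \<Longrightarrow> f s \<in> M) \<Longrightarrow> (\<Sum>s\<in>S. f s) \<in> M"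
  by (induction S rule: infinite_finite_induct) (auto intro: zero_M add_M)

text \<open>The binomial coefficients strictly between the ends are divisible by \<open>p\<close>,
  hence vanish modulo \<open>M\<close>.\<close>

lemma cg_power_prime_add:
  assumes "prime p" "of_nat p \<in> M" "x \<in> R" "y \<in> R"
  shows "cg ((x + y) ^ p) (x ^ p + y ^ p)"
proof -
  have p: "0 < p" using assms(1) by (rule prime_gt_0_nat)
  define f where "f l = of_nat (p choose l) * x ^ l * y ^ (p - l)" for l
  have "(x + y) ^ p = (\<Sum>l\<le>p. f l)" by (simp add: binomial_ring f_def)
  also have "{..p} = insert 0 (insert p {1..<p})" using p by auto
  also have "(\<Sum>l\<in>\<dots>. f l) = y ^ p + (x ^ p + (\<Sum>l\<in>{1..<p}. f l))"
    using p by (simp add: f_def)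
  finally have "(x + y) ^ p - (x ^ p + y ^ p) = (\<Sum>l\<in>{1..<p}. f l)" by simp
  moreover have "f l \<in> M" if "l \<in> {1..<p}" for l
  proof -
    have "p dvd (p choose l)" using that assms(1) by (intro dvd_choose_prime) auto
    then obtain e where "p choose l = p * e" by (elim dvdE)
    then have "f l = (of_nat e * x ^ l * y ^ (p - l)) * of_nat p" by (simp add: f_def algebra_simps)
    then show ?thesis using assms by (simp add: mult_M R_closed)
  qed
  ultimately show ?thesis using assms sum_M[of "{1..<p}" f] by (simp add: cg_def R_closed)
qed

lemma cg_power_prime_power_add:
  assumes p: "prime p" "of_nat p \<in> M" and x: "x \<in> R" and y: "y \<in> R"
  shows "cg ((x + y) ^ (p ^ k)) (x ^ (p ^ k) + y ^ (p ^ k))"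
proof (induction k)
  case 0
  then show ?case using x y by (simp add: cg_refl add_R)
next
  case (Suc k)
  have "cg (((x + y) ^ (p ^ k)) ^ p) ((x ^ (p ^ k) + y ^ (p ^ k)) ^ p)" using Suc by (rule cg_power)
  also have "cg \<dots> ((x ^ (p ^ k)) ^ p + (y ^ (p ^ k)) ^ p)"
    by (rule cg_power_prime_add[OF p power_R[OF x] power_R[OF y]])
  finally show ?case by (simp add: mult.commute flip: power_mult)
qed

end

text \<open>\<open>T\<close> represents the classes of \<open>R\<close> modulo \<open>M\<close>, which form a field with \<open>p ^ k\<close> elements.\<close>

locale residue_system = prime_ideal_of_subring R M for R M :: "'a :: comm_ring_1 set" +
  fixes T :: "'a set" and p k :: nat
  assumes prime_p: "prime p"
    and p_M: "of_nat p \<in> M"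
    and T_R: "T \<subseteq> R"
    and finite_T: "finite T"
    and card_T: "card T = p ^ k"
    and T_distinct: "s \<in> T \<Longrightarrow> t \<in> T \<Longrightarrow> s - t \<in> M \<Longrightarrow> s = t"
    and T_surj: "x \<in> R \<Longrightarrow> \<exists>t\<in>T. x - t \<in> M"
    and frobenius: "x \<in> R \<Longrightarrow> x ^ (p ^ k) - x \<in> M"
begin

lemma cg_frobenius: "x \<in> R \<Longrightarrow> cg (x ^ (p ^ k)) x"
  by (simp add: cg_def power_R frobenius)

text \<open>An injective family of as many classes as \<open>T\<close> has elements meets every
  class once. This is the change of variables for all character sums below.\<close>

lemma class_sum:
  assumes I: "finite I" "card I = p ^ k" and \<phi>: "\<And>i. i \<in> I \<Longrightarrow> \<phi> i \<in> R"
    and inj: "\<And>i j. i \<in> I \<Longrightarrow> j \<in> I \<Longrightarrow> cg (\<phi> i) (\<phi> j) \<Longrightarrow> i = j"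
    and g: "\<And>x y. cg x y \<Longrightarrow> g x = g y"
  shows "(\<Sum>i\<in>I. g (\<phi> i)) = (\<Sum>t\<in>T. g t)"
proof -
  have "\<forall>i\<in>I. \<exists>t\<in>T. cg (\<phi> i) t"
    using T_surj \<phi> T_R unfolding cg_def by blast
  then obtain \<rho> where \<rho>: "\<And>i. i \<in> I \<Longrightarrow> \<rho> i \<in> T" "\<And>i. i \<in> I \<Longrightarrow> cg (\<phi> i) (\<rho> i)" by metis
  have "inj_on \<rho> I"
  proof (rule inj_onI)
    fix i j assume *: "i \<in> I" "j \<in> I" "\<rho> i = \<rho> j"
    then have "cg (\<phi> i) (\<phi> j)" using \<rho>(2) cg_sym cg_trans by metis
    then show "i = j" using inj * by blast
  qed
  moreover from this have "\<rho> ` I = T"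
    using \<rho>(1) I card_T finite_T by (intro card_subset_eq) (auto simp: card_image)
  ultimately have "(\<Sum>t\<in>T. g t) = (\<Sum>i\<in>I. g (\<rho> i))" by (metis sum.reindex_cong)
  also have "\<dots> = (\<Sum>i\<in>I. g (\<phi> i))" by (rule sum.cong[OF refl]) (rule g[OF cg_sym[OF \<rho>(2)]])
  finally show ?thesis by simp
qed

text \<open>Linear algebra over the prime field: the digits are coordinates with respect to a basis
  chosen one vector at a time, so digitwise difference becomes subtraction. For \<open>n = k\<close>
  the coordinates exhaust all classes.\<close>

lemma exists_digit_coordinates:
  "n \<le> k \<Longrightarrow> \<exists>\<beta>. (\<forall>i. \<beta> i \<in> R) \<and>
    (\<forall>i < p ^ n. \<forall>j < p ^ n. cg (\<beta> (digit_diff p n i j)) (\<beta> j - \<beta> i)) \<and>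
    (\<forall>i < p ^ n. \<forall>j < p ^ n. cg (\<beta> i) (\<beta> j) \<longrightarrow> i = j)"
proof (induction n)
  case 0
  show ?case by (intro exI[of _ "\<lambda>_. 0"]) (auto simp: zero_R cg_refl)
next
  case (Suc n)
  have p0: "0 < p" and p2: "2 \<le> p" using prime_p by (auto simp: prime_gt_0_nat prime_ge_2_nat)
  from Suc obtain \<beta> where "\<forall>i. \<beta> i \<in> R"
    and "\<forall>i < p ^ n. \<forall>j < p ^ n. cg (\<beta> (digit_diff p n i j)) (\<beta> j - \<beta> i)"
    and "\<forall>i < p ^ n. \<forall>j < p ^ n. cg (\<beta> i) (\<beta> j) \<longrightarrow> i = j"
    using Suc_leD by blast
  then have \<beta>R: "\<And>i. \<beta> i \<in> R"
    and diff: "\<And>i j. i < p ^ n \<Longrightarrow> j < p ^ n \<Longrightarrow> cg (\<beta> (digit_diff p n i j)) (\<beta> j - \<beta> i)"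
    and inj: "\<And>i j. i < p ^ n \<Longrightarrow> j < p ^ n \<Longrightarrow> cg (\<beta> i) (\<beta> j) \<Longrightarrow> i = j"
    by blast+
  have dd: "digit_diff p n i j < p ^ n" for i j using digit_diff_less[OF p0] .
  have pn: "0 < p ^ n" using p0 by simp
  have \<beta>0: "cg (\<beta> 0) 0"
    using diff[OF pn pn] digit_diff_eq_0_iff[OF p0 pn pn] by simp
  \<comment> \<open>This and the next two facts say that the classes hit by \<open>\<beta>\<close>
    form a subspace; scalars act as integers.\<close>
  have neg: "\<exists>j < p ^ n. cg (- \<beta> i) (\<beta> j)" if i: "i < p ^ n" for i
  proof -
    have "cg (\<beta> (digit_diff p n i 0)) (\<beta> 0 - \<beta> i)" using diff i pn by blast
    also have "cg (\<beta> 0 - \<beta> i) (- \<beta> i)" using cg_diff[OF \<beta>0 cg_refl[OF \<beta>R]] by simp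
    finally show ?thesis using dd cg_sym by blast
  qed
  have nat_mult: "\<exists>j < p ^ n. cg (of_nat m * \<beta> i) (\<beta> j)" if i: "i < p ^ n" for m i
  proof (induction m)
    case 0
    show ?case by (rule exI[of _ 0]) (simp add: p0 cg_sym[OF \<beta>0])
  next
    case (Suc m)
    then obtain j where j: "j < p ^ n" "cg (of_nat m * \<beta> i) (\<beta> j)" by blast
    obtain l where l: "l < p ^ n" "cg (- \<beta> i) (\<beta> l)" using neg[OF i] by blast
    have "cg (of_nat m * \<beta> i - (- \<beta> i)) (\<beta> j - \<beta> l)" by (rule cg_diff[OF j(2) l(2)])
    also have "cg (\<beta> j - \<beta> l) (\<beta> (digit_diff p n l j))" using diff[OF l(1) j(1)] by (rule cg_sym)
    finally show ?case using dd by (auto simp: algebra_simps)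
  qed
  have int_mult: "\<exists>j < p ^ n. cg (of_int m * \<beta> i) (\<beta> j)" if i: "i < p ^ n" for m i
  proof (cases m rule: int_cases2)
    case (nonneg a)
    then show ?thesis using nat_mult[OF i, of a] by simp
  next
    case (nonpos a)
    obtain j where j: "j < p ^ n" "cg (of_nat a * \<beta> i) (\<beta> j)" using nat_mult[OF i] by blast
    obtain l where "l < p ^ n" "cg (- \<beta> j) (\<beta> l)" using neg[OF j(1)] by blast
    then show ?thesis using cg_trans[OF cg_uminus[OF j(2)]] nonpos by auto
  qed
  \<comment> \<open>\<open>\<beta>\<close> covers fewer than \<open>card T\<close> classes; a missing one is the next basis vector.\<close>
  have "\<exists>v\<in>R. \<forall>i < p ^ n. \<not> cg v (\<beta> i)"
  proof (rule ccontr)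
    assume "\<not> ?thesis"
    then have "\<forall>t\<in>T. \<exists>i < p ^ n. cg t (\<beta> i)" using T_R by blast
    then obtain f where f: "\<And>t. t \<in> T \<Longrightarrow> f t < p ^ n" "\<And>t. t \<in> T \<Longrightarrow> cg t (\<beta> (f t))" by metis
    have "inj_on f T"
    proof (rule inj_onI)
      fix s t assume *: "s \<in> T" "t \<in> T" "f s = f t"
      then have "cg s t" using f(2) cg_sym cg_trans by metis
      then show "s = t" using T_distinct * by (simp add: cg_def)
    qed
    then have "card T \<le> card {..<p ^ n}" using f(1) by (intro card_inj_on_le) auto
    then have "p ^ k \<le> p ^ n" by (simp add: card_T)
    then show False using Suc.prems p2 by simp
  qed
  then obtain v where v: "v \<in> R" "\<And>i. i < p ^ n \<Longrightarrow> \<not> cg v (\<beta> i)" by blast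
  \<comment> \<open>The new vector \<open>v\<close> is weighted by the leading digit.\<close>
  define \<gamma> where "\<gamma> x = of_nat (x div p ^ n) * v + \<beta> (x mod p ^ n)" for x
  have \<gamma>R: "\<gamma> x \<in> R" for x by (simp add: \<gamma>_def R_closed v \<beta>R)
  have \<gamma>diff: "cg (\<gamma> (digit_diff p (Suc n) i j)) (\<gamma> j - \<gamma> i)"
    if ij: "i < p ^ Suc n" "j < p ^ Suc n" for i j
  proof -
    let ?i1 = "i div p ^ n" and ?j1 = "j div p ^ n" and ?i2 = "i mod p ^ n" and ?j2 = "j mod p ^ n"
    \<comment> \<open>The quotient \<open>e\<close> records the wrap-around modulo \<open>p\<close>;
      it disappears modulo \<open>M\<close> because \<open>p\<close> lies in
      \<open>M\<close>.\<close>
    define r e where "r = (p + ?j1 - ?i1) mod p" and "e = (p + ?j1 - ?i1) div p"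
    have i1: "?i1 < p" using ij by (auto simp: less_mult_imp_div_less)
    have "r + p * e + ?i1 = p + ?j1" using i1 by (simp add: r_def e_def)
    then have "of_nat (r + p * e + ?i1) = (of_nat (p + ?j1) :: 'a)" by (rule arg_cong)
    then have re: "of_nat r = (of_nat ?j1 - of_nat ?i1 :: 'a) + (1 - of_nat e) * of_nat p"
      by (simp add: algebra_simps)
    have "cg (of_nat r) (of_nat ?j1 - of_nat ?i1)"
      unfolding cg_def re by (auto intro!: R_closed mult_M p_M)
    then have "cg (of_nat r * v + \<beta> (digit_diff p n ?i2 ?j2)) ((of_nat ?j1 - of_nat ?i1) * v + (\<beta> ?j2 - \<beta> ?i2))"
      using diff[of ?i2 ?j2] pn by (intro cg_add cg_mult cg_refl v) auto
    moreover have "\<gamma> (digit_diff p (Suc n) i j) = of_nat r * v + \<beta> (digit_diff p n ?i2 ?j2)"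
      using dd[of ?i2 ?j2] pn by (simp add: \<gamma>_def r_def)
    ultimately show ?thesis by (simp add: \<gamma>_def algebra_simps)
  qed
  \<comment> \<open>By \<open>\<gamma>diff\<close> injectivity amounts to this: only digit
    difference 0 is mapped into \<open>M\<close>.\<close>
  have ker: "d = 0" if d: "d < p ^ Suc n" "\<gamma> d \<in> M" for d
  proof -
    define r where "r = d div p ^ n"
    have r: "r < p" using d by (auto simp: r_def less_mult_imp_div_less)
    have d2: "d mod p ^ n < p ^ n" using pn by simp
    have sum: "of_nat r * v + \<beta> (d mod p ^ n) \<in> M" using d(2) by (simp add: \<gamma>_def r_def)
    have "r = 0"
    proof (rule ccontr)
      \<comment> \<open>A nonzero digit is invertible modulo \<open>p\<close>, with inverse
        \<open>u\<close> from Bezout, so \<open>v\<close> would be congruent to an integer multiple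
        of a value of \<open>\<beta>\<close>.\<close>
      assume "r \<noteq> 0"
      then have "\<not> p dvd r" using r by (auto dest: dvd_imp_le)
      then have "coprime (int r) (int p)"
        using prime_p prime_imp_coprime[of p r] by (simp add: coprime_commute)
      then obtain u w where uw: "u * int r + w * int p = 1"
        by (metis bezout_int coprime_imp_gcd_eq_1)
      have "of_int (u * int r + w * int p) = (1 :: 'a)" unfolding uw by simp
      then have uw': "of_int u * of_nat r + of_int w * of_nat p = (1 :: 'a)" by simp
      have "v - of_int (- u) * \<beta> (d mod p ^ n)
          = (of_int u * of_nat r + of_int w * of_nat p) * v + of_int u * \<beta> (d mod p ^ n)"
        unfolding uw' by simp
      also have "\<dots> = of_int u * (of_nat r * v + \<beta> (d mod p ^ n)) + of_int w * v * of_nat p"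
        by (simp add: algebra_simps)
      also have "\<dots> \<in> M" by (intro add_M mult_M of_int_R mult_R v sum p_M)
      finally have "cg v (of_int (- u) * \<beta> (d mod p ^ n))"
        unfolding cg_def by (auto intro!: R_closed v \<beta>R)
      then show False using int_mult[OF d2, of "- u"] v(2) cg_trans by blast
    qed
    moreover have "d mod p ^ n = 0"
    proof -
      have "cg (\<beta> (d mod p ^ n)) 0" using sum \<open>r = 0\<close> by (simp add: cg_0_iff)
      then have "cg (\<beta> (d mod p ^ n)) (\<beta> 0)" using cg_trans cg_sym[OF \<beta>0] by blast
      then show ?thesis using inj d2 pn by blast
    qed
    ultimately show "d = 0" unfolding r_def by (metis div_mult_mod_eq mult_0 add_0)
  qed
  have "i = j" if ij: "i < p ^ Suc n" "j < p ^ Suc n" "cg (\<gamma> i) (\<gamma> j)" for i j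
  proof -
    have "cg (\<gamma> j - \<gamma> i) 0" using cg_sym[OF ij(3)] M_R by (auto simp: cg_def zero_R)
    then have "\<gamma> (digit_diff p (Suc n) i j) \<in> M"
      using cg_trans[OF \<gamma>diff[OF ij(1,2)]] cg_0_iff by blast
    then have "digit_diff p (Suc n) i j = 0" using ker digit_diff_less[OF p0] by blast
    then show ?thesis using digit_diff_eq_0_iff[OF p0 ij(1,2)] by simp
  qed
  then show ?case using \<gamma>R \<gamma>diff by blast
qed

end

section \<open>Finite fields as residue rings of cyclotomic integers\<close>

text \<open>As \<open>a\<close> is not a unit of \<open>R\<close>, its multiples form a proper
  ideal. Zorn's lemma gives a maximal proper ideal containing \<open>a\<close>, and maximal ideals
  are prime.\<close>

lemma exists_prime_ideal_of_subring:
  fixes R :: "'a :: comm_ring_1 set"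
  assumes one_R: "1 \<in> R"
    and add_R: "\<And>x y. x \<in> R \<Longrightarrow> y \<in> R \<Longrightarrow> x + y \<in> R"
    and uminus_R: "\<And>x. x \<in> R \<Longrightarrow> - x \<in> R"
    and mult_R: "\<And>x y. x \<in> R \<Longrightarrow> y \<in> R \<Longrightarrow> x * y \<in> R"
    and a: "a \<in> R" "\<And>x. x \<in> R \<Longrightarrow> a * x \<noteq> 1"
  shows "\<exists>M. prime_ideal_of_subring R M \<and> a \<in> M"
proof -
  have zero_R: "0 \<in> R" using add_R[OF one_R uminus_R[OF one_R]] by simp
  define \<A> where "\<A> = {I. I \<subseteq> R \<and> a \<in> I \<and> 1 \<notin> I \<and> 0 \<in> I \<and>
    (\<forall>x\<in>I. \<forall>y\<in>I. x + y \<in> I) \<and> (\<forall>r\<in>R. \<forall>x\<in>I. r * x \<in> I)}"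
  have "(\<lambda>x. a * x) ` R \<in> \<A>"
    unfolding \<A>_def
  proof (intro CollectI conjI ballI)
    show "(\<lambda>x. a * x) ` R \<subseteq> R" using a(1) mult_R by auto
    show "a \<in> (\<lambda>x. a * x) ` R" using one_R by (rule rev_image_eqI) simp
    show "1 \<notin> (\<lambda>x. a * x) ` R" using a(2) by force
    show "0 \<in> (\<lambda>x. a * x) ` R" using zero_R by (rule rev_image_eqI) simp
    show "x + y \<in> (\<lambda>x. a * x) ` R" if "x \<in> (\<lambda>x. a * x) ` R" "y \<in> (\<lambda>x. a * x) ` R" for x y
      using that add_R by (auto simp flip: distrib_left)
    show "r * x \<in> (\<lambda>x. a * x) ` R" if "r \<in> R" "x \<in> (\<lambda>x. a * x) ` R" for r x
      using that mult_R by (auto simp: mult.left_commute)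
  qed
  then have "\<A> \<noteq> {}" by blast
  moreover have "\<Union>C \<in> \<A>" if C: "C \<noteq> {}" "subset.chain \<A> C" for C
  proof -
    have CA: "C \<subseteq> \<A>" and tot: "\<And>I J. I \<in> C \<Longrightarrow> J \<in> C \<Longrightarrow> I \<subseteq> J \<or> J \<subseteq> I"
      using C(2) by (auto simp: subset_chain_def)
    have A: "I \<subseteq> R" "a \<in> I" "1 \<notin> I" "0 \<in> I" "\<And>x y. x \<in> I \<Longrightarrow> y \<in> I \<Longrightarrow> x + y \<in> I"
      "\<And>r x. r \<in> R \<Longrightarrow> x \<in> I \<Longrightarrow> r * x \<in> I" if "I \<in> C" for I
      using CA that by (auto simp: \<A>_def)
    obtain I0 where "I0 \<in> C" using C(1) by blast
    have "x + y \<in> \<Union>C" if xy: "x \<in> \<Union>C" "y \<in> \<Union>C" for x y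
    proof -
      obtain I J where IJ: "I \<in> C" "J \<in> C" "x \<in> I" "y \<in> J" using xy by blast
      then have "x + y \<in> I \<or> x + y \<in> J" using tot[OF IJ(1,2)] A(5) by blast
      then show ?thesis using IJ by blast
    qed
    moreover have "a \<in> \<Union>C" "0 \<in> \<Union>C" using \<open>I0 \<in> C\<close> A by blast+
    moreover have "\<Union>C \<subseteq> R" "1 \<notin> \<Union>C" using A(1,3) by blast+
    moreover have "r * x \<in> \<Union>C" if "r \<in> R" "x \<in> \<Union>C" for r x
      using that A(6) by blast
    ultimately show ?thesis unfolding \<A>_def by simp
  qed
  ultimately have "\<exists>M\<in>\<A>. \<forall>X\<in>\<A>. M \<subseteq> X \<longrightarrow> X = M" by (rule subset_Zorn_nonempty)
  then obtain M where M: "M \<in> \<A>" and max: "\<And>X. X \<in> \<A> \<Longrightarrow> M \<subseteq> X \<Longrightarrow> X = M" by blast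
  have I: "M \<subseteq> R" "a \<in> M" "1 \<notin> M" "0 \<in> M" "\<And>x y. x \<in> M \<Longrightarrow> y \<in> M \<Longrightarrow> x + y \<in> M"
      "\<And>r x. r \<in> R \<Longrightarrow> x \<in> M \<Longrightarrow> r * x \<in> M"
    using M by (auto simp: \<A>_def)
  have "x \<in> M \<or> y \<in> M" if x: "x \<in> R" and y: "y \<in> R" and xy: "x * y \<in> M" for x y
  proof (rule ccontr)
    assume no: "\<not> ?thesis"
    \<comment> \<open>The ideal generated by \<open>M\<close> and \<open>x\<close>; it is proper,
      because \<open>1 = m + r * x\<close> would put \<open>y\<close> into \<open>M\<close>.\<close>
    define N where "N = {m + r * x | m r. m \<in> M \<and> r \<in> R}"
    have "M \<subseteq> N" unfolding N_def using zero_R by force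
    have "x \<in> N" unfolding N_def using one_R I(4) by force
    have "N \<subseteq> R" unfolding N_def using I(1) x add_R mult_R by blast
    have "u + v \<in> N" if uv: "u \<in> N" "v \<in> N" for u v
    proof -
      obtain m r m' r' where *: "m \<in> M" "r \<in> R" "m' \<in> M" "r' \<in> R" "u = m + r * x" "v = m' + r' * x"
        using uv unfolding N_def by blast
      then have "u + v = (m + m') + (r + r') * x" by (simp add: algebra_simps)
      then show ?thesis unfolding N_def using * I(5) add_R by blast
    qed
    moreover have "s * u \<in> N" if su: "s \<in> R" "u \<in> N" for s u
    proof -
      obtain m r where *: "m \<in> M" "r \<in> R" "u = m + r * x"
        using su unfolding N_def by blast
      then have "s * u = s * m + (s * r) * x" by (simp add: algebra_simps)
      then show ?thesis unfolding N_def using * I(6) su mult_R by blast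
    qed
    moreover have "1 \<notin> N"
    proof
      assume "1 \<in> N"
      then obtain m r where *: "m \<in> M" "r \<in> R" "1 = m + r * x" unfolding N_def by blast
      have "y = y * (m + r * x)" by (simp flip: *(3))
      also have "\<dots> = y * m + r * (x * y)" by (simp add: algebra_simps)
      also have "\<dots> \<in> M" using * y xy I(5,6) by blast
      finally show False using no by blast
    qed
    moreover have "a \<in> N" "0 \<in> N" using \<open>M \<subseteq> N\<close> I by blast+
    ultimately have "N \<in> \<A>" unfolding \<A>_def using \<open>N \<subseteq> R\<close> by simp
    then show False using max \<open>M \<subseteq> N\<close> \<open>x \<in> N\<close> no by blast
  qed
  then have "prime_ideal_of_subring R M"
    using I by unfold_locales (auto intro: one_R add_R uminus_R mult_R)
  then show ?thesis using I(2) by blast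
qed

section \<open>Integer polynomials in a root of unity\<close>

definition int_adjoin :: "'a :: comm_ring_1 \<Rightarrow> 'a set" where
  "int_adjoin z = range (\<lambda>f. poly (map_poly of_int f) z)"

lemma int_adjoin_closed:
  shows "0 \<in> int_adjoin z" "1 \<in> int_adjoin z" "z \<in> int_adjoin z"
    "x \<in> int_adjoin z \<Longrightarrow> y \<in> int_adjoin z \<Longrightarrow> x + y \<in> int_adjoin z"
    "x \<in> int_adjoin z \<Longrightarrow> - x \<in> int_adjoin z"
    "x \<in> int_adjoin z \<Longrightarrow> y \<in> int_adjoin z \<Longrightarrow> x * y \<in> int_adjoin z"
proof -
  show "0 \<in> int_adjoin z" unfolding int_adjoin_def by (rule range_eqI[of _ _ 0]) simp
  show "1 \<in> int_adjoin z" unfolding int_adjoin_def by (rule range_eqI[of _ _ 1]) simp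
  show "z \<in> int_adjoin z" unfolding int_adjoin_def by (rule range_eqI[of _ _ "[:0, 1:]"]) (simp add: map_poly_pCons)
  show "x + y \<in> int_adjoin z" if xy: "x \<in> int_adjoin z" "y \<in> int_adjoin z"
  proof -
    from xy obtain f g where "x = poly (map_poly of_int f) z" "y = poly (map_poly of_int g) z"
      by (auto simp: int_adjoin_def)
    then show ?thesis unfolding int_adjoin_def by (intro range_eqI[of _ _ "f + g"]) (simp add: of_int_hom.map_poly_hom_add)
  qed
  show "- x \<in> int_adjoin z" if x: "x \<in> int_adjoin z"
  proof -
    from x obtain f where "x = poly (map_poly of_int f) z"
      by (auto simp: int_adjoin_def)
    then show ?thesis unfolding int_adjoin_def by (intro range_eqI[of _ _ "- f"]) (simp add: of_int_poly_hom.hom_uminus)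
  qed
  show "x * y \<in> int_adjoin z" if xy: "x \<in> int_adjoin z" "y \<in> int_adjoin z"
  proof -
    from xy obtain f g where "x = poly (map_poly of_int f) z" "y = poly (map_poly of_int g) z"
      by (auto simp: int_adjoin_def)
    then show ?thesis unfolding int_adjoin_def by (intro range_eqI[of _ _ "f * g"]) (simp add: of_int_poly_hom.hom_mult)
  qed
qed

text \<open>Horner's scheme for the value of an integer polynomial.\<close>

lemma int_adjoin_induct [consumes 1, case_names zero step]:
  assumes "x \<in> int_adjoin z" "P 0"
    "\<And>a y. y \<in> int_adjoin z \<Longrightarrow> P y \<Longrightarrow> P (of_int a + z * y)"
  shows "P x"
proof -
  have "P (poly (map_poly of_int f) z)" for f
  proof (induction f rule: pCons_induct)
    case (pCons a f)
    then show ?case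
      using assms(3)[of "poly (map_poly of_int f) z" a] by (simp add: map_poly_pCons int_adjoin_def)
  qed (simp add: assms(2))
  then show ?thesis using assms(1) by (auto simp: int_adjoin_def)
qed

lemma int_adjoin_root_of_unity_span:
  assumes "x \<in> int_adjoin z" "z ^ n = 1" "0 < n"
  shows "\<exists>c. x = (\<Sum>j<n. of_int (c j) * z ^ j)"
  using assms(1)
proof (induction rule: int_adjoin_induct)
  case zero
  show ?case by (rule exI[of _ "\<lambda>_. 0"]) simp
next
  case (step a y)
  then obtain c where c: "y = (\<Sum>j<n. of_int (c j) * z ^ j)" by blast
  obtain n' where n: "n = Suc n'" using assms(3) by (cases n) auto
  \<comment> \<open>Multiplication by \<open>z\<close> shifts the coefficients cyclically: the top
    one returns to the constant term because \<open>z ^ n = 1\<close>.\<close>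
  define d where "d = case_nat (a + c n') c"
  have "of_int a + z * y = of_int a + (\<Sum>j<n'. of_int (c j) * z ^ Suc j) + of_int (c n') * z ^ n"
    unfolding c n by (simp add: sum_distrib_left algebra_simps)
  also have "\<dots> = (\<Sum>j<n. of_int (d j) * z ^ j)"
    unfolding assms(2) unfolding n by (subst sum.lessThan_Suc_shift) (simp add: d_def)
  finally show ?case by blast
qed

text \<open>\<open>x\<close> is an eigenvalue of the integer matrix of multiplication by \<open>x\<close> on the powers of \<open>z\<close>.\<close>

lemma algebraic_int_int_adjoin:
  fixes z :: complex
  assumes x: "x \<in> int_adjoin z" and z: "z ^ n = 1" "0 < n"
  shows "algebraic_int x"
proof -
  have pow: "z ^ i \<in> int_adjoin z" for i
    by (induction i) (auto intro: int_adjoin_closed simp del: power_Suc simp: power_Suc)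
  have "\<forall>i. \<exists>c. x * z ^ i = (\<Sum>j<n. of_int (c j) * z ^ j)"
    using int_adjoin_root_of_unity_span[OF int_adjoin_closed(6)[OF x pow] z] by blast
  then obtain c where c: "\<And>i. x * z ^ i = (\<Sum>j<n. of_int (c i j) * z ^ j)" by metis
  define B where "B = mat n n (\<lambda>(i, j). c i j)"
  define A :: "complex mat" where "A = map_mat of_int B"
  define v where "v = vec n (\<lambda>i. z ^ i)"
  have B: "B \<in> carrier_mat n n" and A: "A \<in> carrier_mat n n" by (simp_all add: A_def B_def)
  have "A *\<^sub>v v = x \<cdot>\<^sub>v v"
    by (rule eq_vecI) (auto simp: A_def B_def v_def scalar_prod_def c lessThan_atLeast0)
  moreover have "v $ 0 \<noteq> 0\<^sub>v n $ 0" using z by (simp add: v_def)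
  then have "v \<noteq> 0\<^sub>v n" by metis
  ultimately have "eigenvalue A x"
    using A unfolding eigenvalue_def eigenvector_def by (intro exI[of _ v]) (auto simp: v_def)
  then have "poly (char_poly A) x = 0" using eigenvalue_root_char_poly[OF A] by blast
  moreover have "char_poly A = map_poly of_int (char_poly B)"
    unfolding A_def by (rule of_int_hom.char_poly_hom[OF B])
  moreover have "lead_coeff (char_poly B) = 1" using degree_monic_char_poly[OF B] by simp
  ultimately show ?thesis unfolding algebraic_int_altdef_ipoly by metis
qed

text \<open>The polynomial \<open>X^n - 1\<close> has simple roots, hence splits into the distinct
  factors \<open>X - w\<close>. The second product is its derivative at 1, where only the term
  without the factor \<open>X - 1\<close> survives.\<close>

lemma prod_roots_of_unity_diff:
  fixes x :: complex
  assumes n: "0 < n"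
  shows "(\<Prod>w\<in>{w. w ^ n = 1}. x - w) = x ^ n - 1"
    and "(\<Prod>w\<in>{w. w ^ n = 1} - {1}. 1 - w) = (of_nat n :: complex)"
proof -
  define P :: "complex poly" where "P = monom 1 n - 1"
  have P: "poly P y = y ^ n - 1" for y by (simp add: P_def poly_monom)
  have dP: "poly (pderiv P) y = of_nat n * y ^ (n - 1)" for y
    by (simp add: P_def pderiv_diff pderiv_monom poly_monom)
  have fin: "finite {w :: complex. w ^ n = 1}" using n by (intro finite_roots_unity) simp
  have "rsquarefree P"
    unfolding rsquarefree_roots
  proof (intro allI notI, elim conjE)
    fix a assume "poly P a = 0" "poly (pderiv P) a = 0"
    then show False using n by (auto simp: P dP power_0_left)
  qed
  moreover have "lead_coeff P = 1"
  proof -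
    have "degree P = n" using n unfolding P_def diff_conv_add_uminus
      by (subst degree_add_eq_left) (auto simp: degree_monom_eq)
    then show ?thesis using n by (simp add: P_def coeff_diff)
  qed
  ultimately have dec: "(\<Prod>w\<in>{w. w ^ n = 1}. [:- w, 1:]) = P"
    using complex_poly_decompose_rsquarefree[of P] by (simp add: P)
  show "(\<Prod>w\<in>{w. w ^ n = 1}. x - w) = x ^ n - 1"
    using arg_cong[OF dec, of "\<lambda>p. poly p x"] by (simp add: poly_prod P)
  define Q where "Q = (\<Prod>w\<in>{w :: complex. w ^ n = 1} - {1}. [:- w, 1:])"
  have "P = [:- 1, 1:] * Q"
    unfolding dec[symmetric] Q_def using fin by (subst prod.remove[of _ 1]) auto
  then have "poly (pderiv P) 1 = poly Q 1"
    by (simp add: pderiv_mult pderiv_pCons del: mult_pCons_left)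
  then show "(\<Prod>w\<in>{w. w ^ n = 1} - {1}. 1 - w) = (of_nat n :: complex)"
    by (simp add: dP Q_def poly_prod)
qed

text \<open>With \<open>n = q - 1\<close>, 0 and the \<open>n\<close>-th roots of unity are
  \<open>q\<close> elements of \<open>R\<close>. They are incongruent by the value of the product of
  the \<open>1 - w\<close>, and they reach every class because \<open>x ^ q - x\<close> lies in
  \<open>M\<close> and factors over them.\<close>

lemma exists_residue_system:
  assumes p: "prime p" and odd: "odd p" and k: "0 < k"
  shows "\<exists>R M (T :: complex set). residue_system R M T p k"
proof -
  define q where "q = p ^ k"
  define n where "n = q - 1"
  have "1 < q" using p k unfolding q_def by (intro one_less_power prime_gt_1_nat)
  then have n: "0 < n" and q: "q = Suc n" by (auto simp: n_def)
  have odd_q: "odd q" using odd by (simp add: q_def)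
  define z where "z = cis (2 * pi / n)"
  define R where "R = int_adjoin z"
  have z_pow: "cis (2 * pi * real i / real n) = z ^ i" for i
    by (simp add: z_def DeMoivre mult.commute)
  have z: "z ^ n = 1" using n by (simp add: z_def DeMoivre)
  have roots_R: "w \<in> R" if w: "w ^ n = 1" for w
  proof -
    have "w \<in> (\<lambda>i. cis (2 * pi * real i / real n)) ` {..<n}"
      using bij_betw_imp_surj_on[OF bij_betw_roots_unity[OF n]] w by simp
    then obtain i where "w = z ^ i" by (auto simp: z_pow)
    moreover have "z ^ i \<in> R"
      by (induction i) (auto intro: int_adjoin_closed simp del: power_Suc simp: power_Suc R_def)
    ultimately show ?thesis by simp
  qed
  have "of_nat m \<in> R" for m
    unfolding R_def by (induction m) (auto intro: int_adjoin_closed)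
  \<comment> \<open>An inverse of \<open>p\<close> in \<open>R\<close> would be a rational algebraic
    integer, hence an integer.\<close>
  moreover have "of_nat p * x \<noteq> 1" if x: "x \<in> R" for x
  proof
    assume px: "of_nat p * x = 1"
    then have "x = 1 / of_nat p" by (metis mult_zero_left nonzero_eq_divide_eq mult.commute zero_neq_one)
    then have "x \<in> \<rat>" by simp
    moreover have "algebraic_int x" using algebraic_int_int_adjoin[OF _ z n] x by (simp add: R_def)
    ultimately obtain m where "x = of_int m" using rational_algebraic_int_is_int Ints_cases by metis
    then have "of_int (int p * m) = (of_int 1 :: complex)" using px by simp
    then have "int p * m = 1" by (simp only: of_int_eq_iff)
    then have "int p dvd 1" by (metis dvd_triv_left)
    then show False using p by auto
  qed
  ultimately obtain M where M: "prime_ideal_of_subring R M" and pM: "of_nat p \<in> M"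
    using exists_prime_ideal_of_subring[of R "of_nat p"] int_adjoin_closed[where z = z] unfolding R_def by blast
  interpret prime_ideal_of_subring R M by (rule M)
  have qM: "of_nat q \<in> M"
  proof -
    have "q = p ^ (k - 1) * p" unfolding q_def by (rule power_minus_mult[OF k, symmetric])
    then have "of_nat q = of_nat (p ^ (k - 1)) * (of_nat p :: complex)" by (metis of_nat_mult)
    then show ?thesis using mult_M[OF of_nat_R pM] by metis
  qed
  have frob: "cg (x ^ q) x" if "x \<in> R" for x
  proof -
    have add: "cg ((x + y) ^ q) (x + y)" if "cg (x ^ q) x" "cg (y ^ q) y" for x y
    proof -
      have "x \<in> R" "y \<in> R" using that by (auto simp: cg_def)
      then have "cg ((x + y) ^ q) (x ^ q + y ^ q)"
        unfolding q_def by (rule cg_power_prime_power_add[OF p pM])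
      then show ?thesis using cg_trans cg_add that by blast
    qed
    have nat: "cg (of_nat a ^ q) (of_nat a)" for a
    proof (induction a)
      case 0
      show ?case using q by (simp add: cg_refl zero_R)
    next
      case (Suc a)
      show ?case using add[OF Suc, of 1] by (simp add: cg_refl one_R add.commute)
    qed
    have int: "cg (of_int a ^ q) (of_int a)" for a
    proof (cases a rule: int_cases2)
      case (nonpos m)
      \<comment> \<open>Oddness of \<open>q\<close> lets the sign pass through the power.\<close>
      then show ?thesis using cg_uminus[OF nat[of m]] odd_q by simp
    qed (simp add: nat)
    have "x \<in> int_adjoin z" using that by (simp add: R_def)
    then show ?thesis
    proof (induction rule: int_adjoin_induct)
      case zero
      show ?case using q by (simp add: cg_refl zero_R)
    next
      case (step a y)
      \<comment> \<open>Frobenius fixes \<open>z\<close> and the integers, and is additive and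
        multiplicative modulo \<open>M\<close>, so it fixes all of \<open>R\<close> modulo
        \<open>M\<close>.\<close>
      have "z ^ q = z" using z q by simp
      then have "cg ((z * y) ^ q) (z * y)"
        using cg_mult[OF cg_refl[OF roots_R[OF z]] step(2)] by (simp add: power_mult_distrib)
      then show ?case using add[OF int] by blast
    qed
  qed
  define T where "T = insert 0 {w :: complex. w ^ n = 1}"
  have fin: "finite {w :: complex. w ^ n = 1}" using n by (intro finite_roots_unity) simp
  have T_R: "T \<subseteq> R" using zero_R roots_R by (auto simp: T_def)
  have unit: "w \<notin> M" if "w ^ n = 1" for w
  proof
    assume "w \<in> M"
    have "w ^ n = w ^ (n - 1) * w" using n by (metis power_minus_mult)
    then have "w ^ n \<in> M" using mult_M[OF power_R[OF roots_R[OF that]] \<open>w \<in> M\<close>] by simp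
    then show False using that one_M by simp
  qed
  \<comment> \<open>The \<open>1 - w\<close> with \<open>w \<noteq> 1\<close> multiply to \<open>q - 1\<close>, which is not in \<open>M\<close>.\<close>
  have near_one: "w = 1" if w: "w ^ n = 1" "1 - w \<in> M" for w
  proof (rule ccontr)
    assume "w \<noteq> 1"
    then have "(\<Prod>w\<in>{w. w ^ n = 1} - {1}. 1 - w) \<in> M"
      using w fin prod_M[of "{w. w ^ n = 1} - {1}" "\<lambda>w. 1 - w"] roots_R by (auto intro: R_closed)
    then have "of_nat n \<in> M" by (simp add: prod_roots_of_unity_diff(2)[OF n])
    then have "of_nat q - of_nat n \<in> M" by (rule diff_M[OF qM])
    then show False using one_M q by simp
  qed
  have "residue_system R M T p k"
  proof (unfold_locales)
    show "prime p" "of_nat p \<in> M" "T \<subseteq> R" by fact+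
    show "finite T" using fin by (simp add: T_def)
    show "card T = p ^ k"
      using fin card_roots_unity_eq[OF n] n q by (simp add: T_def q_def power_0_left)
    show "s = t" if st: "s \<in> T" "t \<in> T" "s - t \<in> M" for s t
    proof (cases "s = 0 \<or> t = 0")
      case True
      then show ?thesis using st unit uminus_M[of "- s"] uminus_M[of "- t"] n by (auto simp: T_def)
    next
      case False
      then have 1: "s ^ n = 1" "t ^ n = 1" using st by (auto simp: T_def)
      have tt: "t ^ (n - 1) * t = 1" using 1 n by (metis power_minus_mult)
      \<comment> \<open>\<open>u\<close> is the quotient \<open>s / t\<close>, since
        \<open>t ^ (n - 1)\<close> inverts \<open>t\<close>.\<close>
      define u where "u = t ^ (n - 1) * s"
      have "u ^ n = (t ^ n) ^ (n - 1) * s ^ n" by (simp add: u_def power_mult_distrib mult.commute flip: power_mult)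
      then have "u ^ n = 1" using 1 by simp
      moreover have "1 - u \<in> M"
      proof -
        have "t ^ (n - 1) * (s - t) \<in> M" using st T_R by (intro mult_M power_R) auto
        then have "- (t ^ (n - 1) * (s - t)) \<in> M" by (rule uminus_M)
        then show ?thesis using tt by (simp add: u_def right_diff_distrib)
      qed
      ultimately have "u = 1" using near_one by blast
      have "s = t ^ (n - 1) * t * s" unfolding tt by simp
      also have "\<dots> = t * u" by (simp add: u_def mult_ac)
      finally show ?thesis using \<open>u = 1\<close> by simp
    qed
    show "x ^ (p ^ k) - x \<in> M" if "x \<in> R" for x
      using frob[OF that] by (simp add: cg_def q_def)
    show "\<exists>t\<in>T. x - t \<in> M" if x: "x \<in> R" for x
    proof -
      have "x * (x ^ n - 1) = x ^ q - x" by (simp add: q algebra_simps)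
      then have "x * (\<Prod>w\<in>{w. w ^ n = 1}. x - w) \<in> M"
        using frob[OF x] by (simp add: cg_def prod_roots_of_unity_diff(1)[OF n])
      moreover have *: "(\<Prod>w\<in>{w. w ^ n = 1}. x - w) \<in> R \<and>
          ((\<Prod>w\<in>{w. w ^ n = 1}. x - w) \<in> M \<longleftrightarrow> (\<exists>w\<in>{w. w ^ n = 1}. x - w \<in> M))"
        by (rule prod_M[OF fin]) (use x roots_R in \<open>auto intro: diff_R\<close>)
      ultimately have "x \<in> M \<or> (\<exists>w\<in>{w. w ^ n = 1}. x - w \<in> M)"
        using prime_M[OF x] by blast
      then show ?thesis by (auto simp: T_def)
    qed
  qed
  then show ?thesis by blast
qed

section \<open>The Paley core\<close>

locale paley_system = residue_system +
  assumes mod_4: "p ^ k mod 4 = 3"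
begin

text \<open>The exponent of Euler's criterion.\<close>

definition h :: nat where "h = (p ^ k - 1) div 2"

lemma half_order: "p ^ k = 2 * h + 1" "odd h" "0 < h"
  using mod_4 unfolding h_def by presburger+

lemma two_M: "2 \<notin> M"
proof
  assume "2 \<in> M"
  have "odd (p ^ k)" using half_order(1) by simp
  then have "odd p" using mod_4 by (cases k) auto
  then obtain j where "p = 2 * j + 1" by (metis oddE)
  then have "1 = of_nat p - of_nat j * (2 :: 'a)" by simp
  also have "\<dots> \<in> M" by (intro diff_M mult_M p_M of_nat_R \<open>2 \<in> M\<close>)
  finally show False using one_M by simp
qed

text \<open>The differences of signs are at most 2 in absolute value, and neither 1 nor 2 lies in
  \<open>M\<close>. Thus congruences between character values become equalities of integers.\<close>

lemma sign_unique:
  assumes "a \<in> {-1, 0, 1 :: int}" "b \<in> {-1, 0, 1}" "of_int a - of_int b \<in> M"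
  shows "a = b"
proof -
  have "- 1 \<notin> M" "- 2 \<notin> M" using one_M two_M uminus_M by force+
  then show ?thesis using assms one_M two_M by auto
qed

text \<open>The quadratic character is given by Euler's criterion instead of by squares, so
  multiplicativity comes from that of powers. That -1 is the right default on \<open>R\<close> is
  shown next.\<close>

definition \<chi> :: "'a \<Rightarrow> int" where
  "\<chi> x = (if x \<in> M then 0 else if x ^ h - 1 \<in> M then 1 else -1)"

lemma \<chi>_values: "\<chi> x \<in> {-1, 0, 1}"
  by (simp add: \<chi>_def)

text \<open>For \<open>x\<close> outside \<open>M\<close>, the factorisation of
  \<open>x ^ q - x\<close> with \<open>q = p ^ k\<close> as
  \<open>x * (x ^ h - 1) * (x ^ h + 1)\<close> and primality put one of the last two factors into
  \<open>M\<close>.\<close>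

lemma \<chi>_cg:
  assumes x: "x \<in> R" shows "cg (of_int (\<chi> x)) (x ^ h)"
proof (cases "x \<in> M")
  case True
  have "x ^ h = x ^ (h - 1) * x" using half_order(3) by (metis power_minus_mult)
  then have "x ^ h \<in> M" using True x by (simp add: mult_M power_R)
  then show ?thesis using True cg_sym by (simp add: \<chi>_def cg_0_iff[symmetric])
next
  case False
  have "x * ((x ^ h - 1) * (x ^ h + 1)) = x ^ (p ^ k) - x"
    by (simp add: half_order(1) algebra_simps flip: power_add mult_2)
  then have "x * ((x ^ h - 1) * (x ^ h + 1)) \<in> M" using frobenius[OF x] by simp
  then have "(x ^ h - 1) * (x ^ h + 1) \<in> M" using prime_M[OF x] False x by (meson R_closed)
  then have "x ^ h - 1 \<in> M \<or> x ^ h + 1 \<in> M" using prime_M x by (meson R_closed)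
  moreover have "1 - x ^ h \<in> M" if "x ^ h - 1 \<in> M" using uminus_M[OF that] by simp
  moreover have "- 1 - x ^ h \<in> M" if "x ^ h + 1 \<in> M"
    using uminus_M[OF that] by (simp only: minus_add_distrib diff_conv_add_uminus add.commute)
  ultimately show ?thesis using False x by (auto simp: \<chi>_def cg_def R_closed)
qed

lemma \<chi>_eqI: "a \<in> {-1, 0, 1} \<Longrightarrow> x \<in> R \<Longrightarrow> cg (of_int a) (x ^ h) \<Longrightarrow> \<chi> x = a"
  using sign_unique[OF \<chi>_values] cg_trans[OF \<chi>_cg cg_sym] unfolding cg_def by blast

lemma \<chi>_cong: "cg x y \<Longrightarrow> \<chi> x = \<chi> y"
  using \<chi>_eqI[OF \<chi>_values] cg_trans[OF \<chi>_cg cg_power[OF cg_sym]] cg_def by metis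

lemma \<chi>_mult: 
  assumes "x \<in> R" "y \<in> R" shows "\<chi> (x * y) = \<chi> x * \<chi> y"
proof (rule \<chi>_eqI)
  show "\<chi> x * \<chi> y \<in> {-1, 0, 1}" using \<chi>_values[of x] \<chi>_values[of y] by auto
  show "cg (of_int (\<chi> x * \<chi> y)) ((x * y) ^ h)"
    using cg_mult[OF \<chi>_cg \<chi>_cg] assms by (simp add: power_mult_distrib)
qed (use assms in \<open>auto intro: mult_R\<close>)

lemma \<chi>_one: "\<chi> 1 = 1"
  by (simp add: \<chi>_def one_M zero_M)

text \<open>Source of the skewness of the core: \<open>h\<close> is odd because
  \<open>p ^ k mod 4 = 3\<close>, so -1 is a nonresidue.\<close>

lemma \<chi>_uminus: "x \<in> R \<Longrightarrow> \<chi> (- x) = - \<chi> x"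
proof -
  assume x: "x \<in> R"
  have "\<chi> (- 1) = -1"
    by (rule \<chi>_eqI) (use half_order(2) in \<open>auto intro!: cg_refl R_closed\<close>)
  then show ?thesis using \<chi>_mult[of "- 1" x] x by (simp add: R_closed)
qed

lemma \<chi>_0_iff: "\<chi> x = 0 \<longleftrightarrow> x \<in> M"
  by (simp add: \<chi>_def)

lemma \<chi>_square: "x \<notin> M \<Longrightarrow> \<chi> x * \<chi> x = 1"
  by (simp add: \<chi>_def)

text \<open>Negation permutes the classes and reverses the sign of the character, so the sum equals
  its negative.\<close>

lemma \<chi>_sum: "(\<Sum>t\<in>T. \<chi> t) = 0"
proof -
  have "(\<Sum>t\<in>T. \<chi> (- t)) = (\<Sum>t\<in>T. \<chi> t)"
  proof (rule class_sum[OF finite_T card_T])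
    fix s t assume "s \<in> T" "t \<in> T" "cg (- s) (- t)"
    then show "s = t" using cg_uminus[of "- s" "- t"] T_distinct by (auto simp: cg_def)
  qed (use T_R in \<open>auto intro: uminus_R \<chi>_cong\<close>)
  moreover have "(\<Sum>t\<in>T. \<chi> (- t)) = (\<Sum>t\<in>T. - \<chi> t)"
    using T_R by (intro sum.cong) (auto simp: \<chi>_uminus)
  ultimately show ?thesis by (simp add: sum_negf)
qed

text \<open>For invertible \<open>t\<close> the summand is the character of
  \<open>1 + c / t\<close>, which runs over all classes except that of 1. The total is therefore 0
  minus the value 1 at that class.\<close>

lemma \<chi>_correlation:
  assumes c: "c \<in> R" "c \<notin> M"
  shows "(\<Sum>t\<in>T. \<chi> t * \<chi> (t + c)) = -1"
proof -
  \<comment> \<open>\<open>i t\<close> inverts \<open>t\<close> modulo \<open>M\<close>, so \<open>t + c\<close> may be replaced by \<open>t * (1 + c * i t)\<close>.\<close>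
  define i where "i t = t ^ (p ^ k - 2)" for t :: 'a
  have iR: "i t \<in> R" if "t \<in> R" for t using that by (simp add: i_def power_R)
  have inv: "cg (t * t * i t) t" if "t \<in> R" for t
  proof -
    have "t * t * i t = t ^ (Suc (Suc (p ^ k - 2)))" by (simp add: i_def mult.assoc)
    also have "Suc (Suc (p ^ k - 2)) = p ^ k" using half_order by simp
    finally show ?thesis using cg_frobenius[OF that] by simp
  qed
  have i_M: "i t \<in> M \<longleftrightarrow> t \<in> M" if "t \<in> R" for t
  proof
    have "p ^ k - 2 = Suc (p ^ k - 3)" using half_order by simp
    then have "i t = t ^ (p ^ k - 3) * t" by (simp add: i_def power_Suc2 del: power_Suc)
    then show "t \<in> M \<Longrightarrow> i t \<in> M" using that by (simp add: mult_M power_R)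
  qed (use that power_M_iff in \<open>auto simp: i_def\<close>)
  have i_inj: "s - t \<in> M" if s: "s \<in> R" and t: "t \<in> R" and i: "i s - i t \<in> M" for s t
  proof -
    have "s \<in> M \<longleftrightarrow> t \<in> M"
      using i add_M[OF i, of "i t"] diff_M[OF _ i, of "i s"] i_M[OF s] i_M[OF t] by auto
    then have "s - t \<in> M" if "s * t \<in> M"
      using that prime_M[OF s t] diff_M by blast
    moreover have "s * t * (s - t) \<in> M"
    proof -
      \<comment> \<open>The difference of inverses, multiplied by \<open>s * s * t * t\<close>, with
        correction terms that lie in \<open>M\<close> by \<open>inv\<close>.\<close>
      have "s * t * (s - t) = - (s * s * t * t * (i s - i t) + s * s * (t * t * i t - t) - t * t * (s * s * i s - s))"
        by (simp add: algebra_simps)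
      also have "\<dots> \<in> M"
      proof -
        have "s * s * t * t * (i s - i t) \<in> M" by (intro mult_M mult_R s t i)
        moreover have "s * s * (t * t * i t - t) \<in> M" "t * t * (s * s * i s - s) \<in> M"
          using inv[OF s] inv[OF t] s t by (simp_all add: cg_def mult_M mult_R)
        ultimately show ?thesis by (intro uminus_M[OF diff_M[OF add_M]])
      qed
      finally show ?thesis .
    qed
    ultimately show ?thesis using prime_M[of "s * t" "s - t"] s t by (auto simp: R_closed)
  qed
  \<comment> \<open>For \<open>t\<close> in \<open>M\<close> the left side is 0, while
    \<open>i t\<close> also lies in \<open>M\<close> and the character gives 1, whence the
    subtracted term.\<close>
  have summand: "\<chi> t * \<chi> (t + c) = \<chi> (1 + c * i t) - (if t \<in> M then 1 else 0)" if "t \<in> T" for t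
  proof -
    have t: "t \<in> R" using that T_R by blast
    show ?thesis
    proof (cases "t \<in> M")
      case True
      then have "cg (1 + c * i t) 1"
        using c t iR i_M by (simp add: cg_def R_closed mult_M)
      then show ?thesis using True \<chi>_cong[of "1 + c * i t" 1] \<chi>_0_iff[of t] by (simp add: \<chi>_one)
    next
      case False
      have "t * (t * i t - 1) \<in> M" using inv[OF t] by (simp add: cg_def algebra_simps)
      then have "t * i t - 1 \<in> M" using prime_M[OF t] False t iR by (meson R_closed)
      then have "c * (t * i t - 1) \<in> M" using c by (simp add: mult_M)
      then have "cg (t * (1 + c * i t)) (t + c)" using c t iR by (simp add: cg_def R_closed algebra_simps)
      then have "\<chi> (t + c) = \<chi> t * \<chi> (1 + c * i t)"
        using \<chi>_cong \<chi>_mult[of t "1 + c * i t"] c t iR by (simp add: R_closed)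
      then show ?thesis using False \<chi>_square[of t] by (simp flip: mult.assoc)
    qed
  qed
  have "(\<Sum>t\<in>T. \<chi> (1 + c * i t)) = (\<Sum>t\<in>T. \<chi> t)"
  proof (rule class_sum[OF finite_T card_T])
    fix s t assume st: "s \<in> T" "t \<in> T" "cg (1 + c * i s) (1 + c * i t)"
    then have R: "s \<in> R" "t \<in> R" using T_R by auto
    have "c * (i s - i t) \<in> M" using st(3) by (simp add: cg_def algebra_simps)
    then have "i s - i t \<in> M" using prime_M[OF c(1)] c(2) R iR by (meson R_closed)
    then show "s = t" using i_inj R T_distinct st by blast
  qed (use T_R c iR in \<open>auto intro!: R_closed \<chi>_cong\<close>)
  moreover have "(\<Sum>t\<in>T. if t \<in> M then 1 else 0 :: int) = 1"
  proof -
    obtain z where z: "z \<in> T" "0 - z \<in> M" using T_surj[OF zero_R] by blast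
    then have "z \<in> M" using uminus_M[of "- z"] by simp
    then have "t \<in> M \<longleftrightarrow> t = z" if "t \<in> T" for t
      using that T_distinct[OF _ z(1)] diff_M by blast
    then have "(\<Sum>t\<in>T. if t \<in> M then 1 else 0 :: int) = (\<Sum>t\<in>T. if t = z then 1 else 0)"
      by (intro sum.cong) auto
    then show ?thesis using z finite_T by simp
  qed
  ultimately show ?thesis
    by (simp add: summand sum_subtractf \<chi>_sum)
qed

text \<open>Paley's construction. Indexing the field by digit coordinates makes each entry depend on
  the digit difference of its indices.\<close>

lemma exists_skew_symmetric_core:
  "\<exists>Q g. skew_symmetric_core (p ^ k) Q \<and>
    (\<forall>i < p ^ k. \<forall>j < p ^ k. Q $$ (i, j) = g (digit_diff p k i j))"
proof -
  obtain \<beta> where "\<forall>i. \<beta> i \<in> R"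
    and "\<forall>i < p ^ k. \<forall>j < p ^ k. cg (\<beta> (digit_diff p k i j)) (\<beta> j - \<beta> i)"
    and "\<forall>i < p ^ k. \<forall>j < p ^ k. cg (\<beta> i) (\<beta> j) \<longrightarrow> i = j"
    using exists_digit_coordinates[OF order_refl] by blast
  then have \<beta>R: "\<And>i. \<beta> i \<in> R"
    and diff: "\<And>i j. i < p ^ k \<Longrightarrow> j < p ^ k \<Longrightarrow> cg (\<beta> (digit_diff p k i j)) (\<beta> j - \<beta> i)"
    and inj: "\<And>i j. i < p ^ k \<Longrightarrow> j < p ^ k \<Longrightarrow> cg (\<beta> i) (\<beta> j) \<Longrightarrow> i = j"
    by blast+
  \<comment> \<open>A translate of the coordinates still meets every class once.\<close>
  have shift: "(\<Sum>l<p ^ k. g (\<beta> l - a)) = (\<Sum>t\<in>T. g t)"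
    if a: "a \<in> R" and g: "\<And>x y. cg x y \<Longrightarrow> g x = g y" for a and g :: "'a \<Rightarrow> int"
  proof (rule class_sum[of _ "\<lambda>l. \<beta> l - a"])
    fix i j assume "i \<in> {..<p ^ k}" "j \<in> {..<p ^ k}" "cg (\<beta> i - a) (\<beta> j - a)"
    then show "i = j" using inj[of i j] \<beta>R by (simp add: cg_def)
  qed (use a g \<beta>R in \<open>auto intro: diff_R\<close>)
  define Q where "Q = mat (p ^ k) (p ^ k) (\<lambda>(i, j). \<chi> (\<beta> j - \<beta> i))"
  have Qij: "Q $$ (i, j) = \<chi> (\<beta> j - \<beta> i)" if "i < p ^ k" "j < p ^ k" for i j
    using that by (simp add: Q_def)
  have notM: "\<beta> j - \<beta> i \<notin> M" if "i < p ^ k" "j < p ^ k" "i \<noteq> j" for i j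
    using inj[of j i] that \<beta>R by (auto simp: cg_def)
  have "skew_symmetric_core (p ^ k) Q"
  proof (rule skew_symmetric_coreI)
    show "0 < p ^ k" using half_order by simp
    show "Q \<in> carrier_mat (p ^ k) (p ^ k)" by (simp add: Q_def)
    show "Q $$ (i, i) = 0" if "i < p ^ k" for i
      using that by (simp add: Qij \<chi>_0_iff zero_M)
    show "Q $$ (i, j) \<in> {1, -1}" if "i < p ^ k" "j < p ^ k" "i \<noteq> j" for i j
      using \<chi>_values[of "\<beta> j - \<beta> i"] notM[OF that] that by (auto simp: Qij \<chi>_0_iff)
    show "Q $$ (j, i) = - Q $$ (i, j)" if "i < p ^ k" "j < p ^ k" for i j
      using \<chi>_uminus[of "\<beta> j - \<beta> i"] that \<beta>R by (simp add: Qij diff_R)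
    show "(\<Sum>l<p ^ k. Q $$ (i, l)) = 0" if "i < p ^ k" for i
      using shift[of "\<beta> i" \<chi>] that \<beta>R \<chi>_cong \<chi>_sum by (simp add: Qij)
    show "(\<Sum>l<p ^ k. Q $$ (i, l) * Q $$ (j, l)) = -1" if "i < p ^ k" "j < p ^ k" "i \<noteq> j" for i j
    proof -
      \<comment> \<open>With \<open>t = \<beta> l - \<beta> i\<close> one has
        \<open>\<beta> l - \<beta> j = t + c\<close>, so the row product is the correlation sum at
        \<open>c\<close>.\<close>
      define c where "c = \<beta> i - \<beta> j"
      have c: "c \<in> R" "c \<notin> M" using notM[of j i] that \<beta>R by (auto simp: c_def diff_R)
      have "\<chi> x * \<chi> (x + c) = \<chi> y * \<chi> (y + c)" if "cg x y" for x y
        using \<chi>_cong[OF that] \<chi>_cong[OF cg_add[OF that cg_refl[OF c(1)]]] by simp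
      then have "(\<Sum>l<p ^ k. \<chi> (\<beta> l - \<beta> i) * \<chi> (\<beta> l - \<beta> i + c)) = -1"
        using shift[of "\<beta> i" "\<lambda>x. \<chi> x * \<chi> (x + c)"] \<beta>R \<chi>_correlation[OF c] by simp
      then show ?thesis using that by (simp add: Qij c_def)
    qed
  qed
  moreover have "Q $$ (i, j) = \<chi> (\<beta> (digit_diff p k i j))" if "i < p ^ k" "j < p ^ k" for i j
    using \<chi>_cong[OF diff[OF that]] that by (simp add: Qij)
  ultimately show ?thesis by (intro exI[of _ Q] exI[of _ "\<lambda>d. \<chi> (\<beta> d)"]) simp
qed

end

text \<open>For the first part \<open>core_QUH\<close> of any given core is a witness; for the
  second, the Paley core is chosen so that the same matrices are also multicirculant.\<close>

theorem theorem3p3: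
  fixes q :: nat
  shows "((\<exists>Q. skew_symmetric_core q Q) \<longrightarrow>
           (\<forall>m::nat. m \<ge> 1 \<longrightarrow>
             (\<exists>H. QUH (q ^ m) q H \<and> regular_unit_hadamard (q ^ m) H \<and>
                  cmod (sum_mat H) = real q powr (3 * real m / 2))))
       \<and> (primepow q \<and> odd q \<and> q mod 4 = 3 \<longrightarrow>
           (\<exists>Q. skew_symmetric_core q Q \<and>
             (\<forall>m::nat. m \<ge> 1 \<longrightarrow>
               QUH (q ^ m) q (core_QUH q Q m) \<and>
               regular_unit_hadamard (q ^ m) (core_QUH q Q m) \<and>
               cmod (sum_mat (core_QUH q Q m)) = real q powr (3 * real m / 2) \<and>
               multicirculant (core_QUH q Q m))))"
proof (intro conjI impI)
  assume "\<exists>Q. skew_symmetric_core q Q"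
  then show "\<forall>m::nat. m \<ge> 1 \<longrightarrow>
      (\<exists>H. QUH (q ^ m) q H \<and> regular_unit_hadamard (q ^ m) H \<and>
        cmod (sum_mat H) = real q powr (3 * real m / 2))"
    using core_QUH_regular by blast
next
  assume "primepow q \<and> odd q \<and> q mod 4 = 3"
  then obtain p k where p: "prime p" and k: "0 < k" and q: "q = p ^ k" and mod_4: "p ^ k mod 4 = 3"
    and odd: "odd p"
    by (auto simp: primepow_def)
  obtain R M and T :: "complex set" where "residue_system R M T p k"
    using exists_residue_system[OF p odd k] by blast
  then interpret paley_system R M T p k
    by (rule paley_system.intro) (unfold_locales, rule mod_4)
  obtain Q g where Q: "skew_symmetric_core (p ^ k) Q"
    and g: "\<And>i j. i < p ^ k \<Longrightarrow> j < p ^ k \<Longrightarrow> Q $$ (i, j) = g (digit_diff p k i j)"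
    using exists_skew_symmetric_core by blast
  have "multicirculant (core_QUH q Q m)" for m
    unfolding q
    by (rule multicirculant_core_QUH[OF prime_ge_2_nat[OF p] skew_symmetric_coreD(2)[OF Q] g])
  then show "\<exists>Q. skew_symmetric_core q Q \<and>
      (\<forall>m::nat. m \<ge> 1 \<longrightarrow>
        QUH (q ^ m) q (core_QUH q Q m) \<and>
        regular_unit_hadamard (q ^ m) (core_QUH q Q m) \<and>
        cmod (sum_mat (core_QUH q Q m)) = real q powr (3 * real m / 2) \<and>
        multicirculant (core_QUH q Q m))"
    using Q core_QUH_regular unfolding q by blast
qed

end
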